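(* Let $A$ be a power-bounded operator on a reflexive Banach space $X$, with $\sigma(A)$ contained in the closed unit disk (discrete-time case) or inside a sector $\{re^{i\theta}:|\theta|<\Theta\}$ with $\Theta<\pi/2$ (continuous-time case). Assume $A$ is either (i) a Ritt operator of angle $<\pi/2$, or (ii) such that $-A$ generates a bounded holomorphic $C_0$-semigroup, and that in either case $A$ has a bounded $H^\infty$ functional calculus on the disk/sector. Let $\varphi_1,\dots,\varphi_K$ be bounded holomorphic functions on the spectral domain, with $\sup_{\lambda\in\sigma(A)}|\varphi_k(\lambda)|\le 1$ and $\varphi_k(1)=1$. Set $\Psi:=\varphi_K\circ\cdots\circ\varphi_1$, and assume moreover that $\Psi(A)$ is power-bounded (which holds in particular if $\sup_{\lambda\in\sigma(A)}|\Psi(\lambda)|\le 1$, by the functional calculus). Then the following hold: (a) The mean ergodic projection $P=\lim_{N\to\infty}\frac1N\sum_{n=0}^{N-1}(\Psi(A))^n$ exists in $B(X)$ (the limit is taken in the strong operator topology, equivalently in the weak operator topology on reflexive $X$). This $P$ is a bounded projection satisfying $P\,\Psi(A)=\Psi(A)\,P=P$ and $\mathrm{Ran}\,P=\ker(I-\Psi(A))=\{x\in X:\Psi(A)x=x\}$. Moreover, $P$ commutes with $A$. (b) If, in addition, $\sigma(\Psi(A))\cap\mathbb{T}\subseteq\{1\}$ and $1$ is an isolated point of $\sigma(\Psi(A))$ that is a pole of the resolvent of $\Psi(A)$, then in fact $\lim_{n\to\infty}(\Psi(A))^n=P$ in the strong operator topology, i.e. the powers of $\Psi(A)$ converge strongly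 to the projection $P$. In particular, $A^{(n)}=(\Psi\circ\cdots\circ\Psi)(A)=(\Psi(A))^n$ (with $n$ copies of $\Psi$ in the composition) converges strongly to $P$ as $n\to\infty$.
   Context: $\mathbb{T}$ is the unit circle, $\mathbb{D}$ the open unit disk, $B(X)$ the bounded linear operators on $X$, and $\sigma(\cdot)$ the spectrum. A Ritt operator on $X$ is here an operator $A$ with $\sigma(A)\subseteq\overline{\mathbb{D}}$ (possibly $1\in\sigma(A)$) satisfying the resolvent condition $\sup_{|z|>1}(|z|-1)\,\|(zI-A)^{-1}\|<\infty$; its angle refers to the opening at $1$ of a Stolz domain containing $\sigma(A)$. In the continuous-time case, $\sigma(A)$ lies in the sector above (possibly $0\in\sigma(A)$), with appropriate resolvent bounds ensuring an $H^\infty$ calculus. The spectral domain is a Stolz disk containing $\sigma(A)$ in the discrete-time case, or a sector containing $\sigma(A)$ in the continuous-time case. A bounded $H^\infty$ functional calculus on the spectral domain is an algebra homomorphism $g\mapsto g(A)$ from the bounded holomorphic functions on that domain into $B(X)$ with $\|g(A)\|\le C\|g\|_\infty$ for some constant $C$; each $g(A)$ commutes with $A$. $\varphi_k(A)$ and $\Psi(A)$ are defined by this calculus. $A^{(n)}$ denotes the iterative sequence $A^{(n)}=(\Psi(A))^n$ for $n\ge 1$, with $A^{(0)}=A$.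
   Formalization: The n-fold composition (Ψ∘…∘Ψ)(A) is replaced by the n-fold product (Ψ^n)(A), since the composition formula fails already for Ψ(z)=z; the parenthetical that sup over σ(A) of |Ψ| ≤ 1 gives power-boundedness is dropped as false; the partial compositions of the φ_k are assumed to be defined. *)

theory Defs
  imports "HOL-Analysis.Analysis"
begin

section \<open>Complex Banach spaces and bounded operators\<close>

class complex_banach = banach +
  fixes scaleC :: "complex \<Rightarrow> 'a \<Rightarrow> 'a"  (infixr \<open>*\<^sub>C\<close> 75)
  assumes scaleC_add_right: "c *\<^sub>C (x + y) = c *\<^sub>C x + c *\<^sub>C y"
    and scaleC_add_left: "(c + d) *\<^sub>C x = c *\<^sub>C x + d *\<^sub>C x"
    and scaleC_scaleC: "c *\<^sub>C d *\<^sub>C x = (c * d) *\<^sub>C x"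
    and scaleC_of_real: "complex_of_real r *\<^sub>C x = r *\<^sub>R x"
    and norm_scaleC: "norm (c *\<^sub>C x) = cmod c * norm x"

instantiation complex :: complex_banach
begin

definition scaleC_complex :: "complex \<Rightarrow> complex \<Rightarrow> complex"
  where "scaleC_complex = (*)"

instance
  by standard (simp_all add: scaleC_complex_def algebra_simps norm_mult scaleR_conv_of_real)

end

definition bounded_clinear :: "('a::complex_banach \<Rightarrow> 'b::complex_banach) \<Rightarrow> bool"
  where "bounded_clinear T \<longleftrightarrow> bounded_linear T \<and> (\<forall>c x. T (c *\<^sub>C x) = c *\<^sub>C T x)"

text \<open>Surjectivity of the canonical map into the bidual; \<^term>\<open>F\<close> is a bounded linear functional
  on the dual, whose norm is \<^const>\<open>onorm\<close>.\<close>

definition reflexive_space :: "'a::complex_banach itself \<Rightarrow> bool"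
  where "reflexive_space _ \<longleftrightarrow>
    (\<forall>F :: ('a \<Rightarrow> complex) \<Rightarrow> complex.
       (\<forall>f g. bounded_clinear f \<and> bounded_clinear g \<longrightarrow> F (\<lambda>x. f x + g x) = F f + F g) \<and>
       (\<forall>c f. bounded_clinear f \<longrightarrow> F (\<lambda>x. c * f x) = c * F f) \<and>
       (\<exists>M. \<forall>f. bounded_clinear f \<longrightarrow> cmod (F f) \<le> M * onorm f)
       \<longrightarrow> (\<exists>x. \<forall>f. bounded_clinear f \<longrightarrow> F f = f x))"

definition spectrum :: "('a::complex_banach \<Rightarrow> 'a) \<Rightarrow> complex set"
  where "spectrum T = {z. \<not> (\<exists>S. bounded_clinear S \<and>
           S \<circ> (\<lambda>x. z *\<^sub>C x - T x) = id \<and> (\<lambda>x. z *\<^sub>C x - T x) \<circ> S = id)}"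

text \<open>Only meaningful for \<^term>\<open>z \<notin> spectrum T\<close>.\<close>

definition resolvent :: "('a::complex_banach \<Rightarrow> 'a) \<Rightarrow> complex \<Rightarrow> 'a \<Rightarrow> 'a"
  where "resolvent T z = inv (\<lambda>x. z *\<^sub>C x - T x)"

definition power_bounded :: "('a::complex_banach \<Rightarrow> 'a) \<Rightarrow> bool"
  where "power_bounded T \<longleftrightarrow> bounded_clinear T \<and> (\<exists>M. \<forall>n. onorm (T ^^ n) \<le> M)"

text \<open>\<^term>\<open>a\<close> is a pole (of order \<^term>\<open>m\<close>) of the resolvent: near \<^term>\<open>a\<close> there is a norm-convergent
  Laurent expansion \<^term>\<open>resolvent T z\<close> $= \sum_{n \ge 0} (z-a)^{n-m} U_n$ with
  $m \ge 1$ and $U_0 \ne 0$.\<close>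

definition resolvent_pole :: "('a::complex_banach \<Rightarrow> 'a) \<Rightarrow> complex \<Rightarrow> bool"
  where "resolvent_pole T a \<longleftrightarrow>
    (\<exists>m r U. 0 < (m::nat) \<and> 0 < (r::real) \<and>
       (\<forall>n::nat. bounded_clinear (U n)) \<and> U 0 \<noteq> (\<lambda>x. 0) \<and>
       (\<forall>z. 0 < dist z a \<and> dist z a < r \<longrightarrow>
          z \<notin> spectrum T \<and>
          (\<lambda>N. onorm (\<lambda>x. (z - a) ^ m *\<^sub>C resolvent T z x - (\<Sum>n<N. (z - a) ^ n *\<^sub>C U n x)))
            \<longlonglongrightarrow> 0))"

definition strong_limit :: "(nat \<Rightarrow> 'a::complex_banach \<Rightarrow> 'a) \<Rightarrow> ('a \<Rightarrow> 'a) \<Rightarrow> bool"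
  where "strong_limit S Q \<longleftrightarrow> (\<forall>x. (\<lambda>N. S N x) \<longlonglongrightarrow> Q x)"

definition weak_limit :: "(nat \<Rightarrow> 'a::complex_banach \<Rightarrow> 'a) \<Rightarrow> ('a \<Rightarrow> 'a) \<Rightarrow> bool"
  where "weak_limit S Q \<longleftrightarrow>
    (\<forall>x. \<forall>f :: 'a \<Rightarrow> complex. bounded_clinear f \<longrightarrow> (\<lambda>N. f (S N x)) \<longlonglongrightarrow> f (Q x))"

definition ergodic_mean :: "('a::complex_banach \<Rightarrow> 'a) \<Rightarrow> nat \<Rightarrow> 'a \<Rightarrow> 'a"
  where "ergodic_mean T N x = (1 / real N) *\<^sub>R (\<Sum>n<N. (T ^^ n) x)"

definition iterative_sequence ::
    "('a::complex_banach \<Rightarrow> 'a) \<Rightarrow> ('a \<Rightarrow> 'a) \<Rightarrow> nat \<Rightarrow> 'a \<Rightarrow> 'a"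
  where "iterative_sequence A T n = (if n = 0 then A else T ^^ n)"

section \<open>Spectral domains and the two classes of operators\<close>

text \<open>Both domains are open. The vertex (\<open>1\<close> for the Stolz domain, \<open>0\<close> for the sector) is a boundary
  point that is allowed to belong to the spectrum, so ``the domain contains the spectrum'' means
  containment after adjoining the vertex. Angles are half-openings.\<close>

definition stolz :: "real \<Rightarrow> complex set"
  where "stolz \<gamma> = interior (convex hull (insert 1 (cball 0 (sin \<gamma>))))"

definition sector :: "real \<Rightarrow> complex set"
  where "sector \<Theta> = {complex_of_real r * cis \<theta> |r \<theta>. 0 < r \<and> \<bar>\<theta>\<bar> < \<Theta>}"

definition ritt_operator :: "('a::complex_banach \<Rightarrow> 'a) \<Rightarrow> bool"
  where "ritt_operator A \<longleftrightarrow> bounded_clinear A \<and> spectrum A \<subseteq> cball 0 1 \<and>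
    bdd_above ((\<lambda>z. (cmod z - 1) * onorm (resolvent A z)) ` {z. 1 < cmod z})"

definition ritt_operator_of_angle :: "('a::complex_banach \<Rightarrow> 'a) \<Rightarrow> real \<Rightarrow> bool"
  where "ritt_operator_of_angle A \<gamma> \<longleftrightarrow> ritt_operator A \<and> spectrum A \<subseteq> insert 1 (stolz \<gamma>)"

definition c0_semigroup :: "(real \<Rightarrow> 'a::complex_banach \<Rightarrow> 'a) \<Rightarrow> bool"
  where "c0_semigroup S \<longleftrightarrow> (\<forall>t\<ge>0. bounded_clinear (S t)) \<and> S 0 = id \<and>
    (\<forall>s\<ge>0. \<forall>t\<ge>0. S (s + t) = S s \<circ> S t) \<and> (\<forall>x. ((\<lambda>t. S t x) \<longlongrightarrow> x) (at_right 0))"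

text \<open>For an everywhere defined operator \<^term>\<open>G\<close>.\<close>

definition generates :: "('a::complex_banach \<Rightarrow> 'a) \<Rightarrow> (real \<Rightarrow> 'a \<Rightarrow> 'a) \<Rightarrow> bool"
  where "generates G S \<longleftrightarrow> (\<forall>x. ((\<lambda>h. (1 / h) *\<^sub>R (S h x - x)) \<longlongrightarrow> G x) (at_right 0))"

definition operator_holomorphic_on ::
    "(complex \<Rightarrow> 'a::complex_banach \<Rightarrow> 'a) \<Rightarrow> complex set \<Rightarrow> bool"
  where "operator_holomorphic_on F \<Omega> \<longleftrightarrow>
    (\<forall>z\<in>\<Omega>. \<exists>D. bounded_clinear D \<and>
       ((\<lambda>w. onorm (\<lambda>x. (1 / (w - z)) *\<^sub>C (F w x - F z x) - D x)) \<longlongrightarrow> 0) (at z within \<Omega>))"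

definition bounded_holomorphic_semigroup :: "(real \<Rightarrow> 'a::complex_banach \<Rightarrow> 'a) \<Rightarrow> bool"
  where "bounded_holomorphic_semigroup S \<longleftrightarrow> c0_semigroup S \<and>
    (\<exists>\<delta> F. 0 < \<delta> \<and> \<delta> \<le> pi / 2 \<and>
       (\<forall>t\<ge>0. F (complex_of_real t) = S t) \<and>
       (\<forall>z\<in>sector \<delta>. bounded_clinear (F z)) \<and>
       (\<forall>z\<in>sector \<delta>. \<forall>w\<in>sector \<delta>. F (z + w) = F z \<circ> F w) \<and>
       operator_holomorphic_on F (sector \<delta>) \<and>
       (\<forall>\<delta>'. 0 < \<delta>' \<and> \<delta>' < \<delta> \<longrightarrow>
          (\<forall>x. ((\<lambda>z. F z x) \<longlongrightarrow> x) (at 0 within sector \<delta>')) \<and>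
          bdd_above ((\<lambda>z. onorm (F z)) ` sector \<delta>')))"

section \<open>Bounded holomorphic functional calculus\<close>

definition Hinf :: "complex set \<Rightarrow> (complex \<Rightarrow> complex) set"
  where "Hinf \<Omega> = {g. g holomorphic_on \<Omega> \<and> bounded (g ` \<Omega>)}"

text \<open>\<^term>\<open>\<Phi> g\<close> is $g(A)$. The calculus is tied to \<^term>\<open>A\<close> through the resolvent functions, because
  the coordinate function is not bounded on a sector. The norm bound makes \<^term>\<open>\<Phi> g\<close> depend only
  on the values of \<^term>\<open>g\<close> on \<^term>\<open>\<Omega>\<close>.\<close>

definition bounded_Hinf_calculus ::
    "complex set \<Rightarrow> ('a::complex_banach \<Rightarrow> 'a) \<Rightarrow> ((complex \<Rightarrow> complex) \<Rightarrow> 'a \<Rightarrow> 'a) \<Rightarrow> bool"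
  where "bounded_Hinf_calculus \<Omega> A \<Phi> \<longleftrightarrow>
    (\<forall>g\<in>Hinf \<Omega>. bounded_clinear (\<Phi> g)) \<and>
    (\<forall>g\<in>Hinf \<Omega>. \<forall>h\<in>Hinf \<Omega>. \<Phi> (\<lambda>z. g z + h z) = (\<lambda>x. \<Phi> g x + \<Phi> h x)) \<and>
    (\<forall>c. \<forall>g\<in>Hinf \<Omega>. \<Phi> (\<lambda>z. c * g z) = (\<lambda>x. c *\<^sub>C \<Phi> g x)) \<and>
    (\<forall>g\<in>Hinf \<Omega>. \<forall>h\<in>Hinf \<Omega>. \<Phi> (\<lambda>z. g z * h z) = \<Phi> g \<circ> \<Phi> h) \<and>
    \<Phi> (\<lambda>z. 1) = id \<and>
    (\<forall>\<mu>. \<mu> \<notin> closure \<Omega> \<longrightarrow> \<Phi> (\<lambda>z. 1 / (\<mu> - z)) = resolvent A \<mu>) \<and>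
    (\<exists>C. \<forall>g\<in>Hinf \<Omega>. onorm (\<Phi> g) \<le> C * (SUP z\<in>\<Omega>. cmod (g z)))"

text \<open>\<open>compose_upto \<phi> k\<close> is $\varphi_k \circ \cdots \circ \varphi_1$.\<close>

primrec compose_upto :: "(nat \<Rightarrow> complex \<Rightarrow> complex) \<Rightarrow> nat \<Rightarrow> complex \<Rightarrow> complex"
  where
    "compose_upto \<phi> 0 = id"
  | "compose_upto \<phi> (Suc k) = \<phi> (Suc k) \<circ> compose_upto \<phi> k"

lemma resolvent_inverse:
  assumes "z \<notin> spectrum T"
  shows "resolvent T z \<circ> (\<lambda>x. z *\<^sub>C x - T x) = id" "(\<lambda>x. z *\<^sub>C x - T x) \<circ> resolvent T z = id"
proof -
  obtain S where S: "S \<circ> (\<lambda>x. z *\<^sub>C x - T x) = id" "(\<lambda>x. z *\<^sub>C x - T x) \<circ> S = id"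
    using assms by (auto simp: spectrum_def)
  then have "resolvent T z = S"
    unfolding resolvent_def by (metis inv_unique_comp)
  with S show "resolvent T z \<circ> (\<lambda>x. z *\<^sub>C x - T x) = id"
    "(\<lambda>x. z *\<^sub>C x - T x) \<circ> resolvent T z = id" by auto
qed

lemma Hinf_resolvent_function:
  assumes "\<mu> \<notin> closure \<Omega>"
  shows "(\<lambda>z. 1 / (\<mu> - z)) \<in> Hinf \<Omega>"
proof -
  obtain d where d: "d > 0" "\<And>z. z \<in> \<Omega> \<Longrightarrow> d \<le> dist z \<mu>"
    using assms by (force simp: closure_approachable not_less)
  have "\<mu> \<notin> \<Omega>" using assms closure_subset by blast
  then have "(\<lambda>z. 1 / (\<mu> - z)) holomorphic_on \<Omega>"
    by (intro holomorphic_intros) auto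
  moreover have "cmod (1 / (\<mu> - z)) \<le> 1 / d" if "z \<in> \<Omega>" for z
    using d(1) d(2)[OF that] by (simp add: norm_divide dist_norm norm_minus_commute frac_le)
  then have "bounded ((\<lambda>z. 1 / (\<mu> - z)) ` \<Omega>)"
    by (auto simp: bounded_iff)
  ultimately show ?thesis by (simp add: Hinf_def)
qed

lemma bounded_Hinf_calculus_commute:
  assumes \<Phi>: "bounded_Hinf_calculus \<Omega> A \<Phi>" and g: "g \<in> Hinf \<Omega>"
    and \<mu>: "\<mu> \<notin> closure \<Omega>" "\<mu> \<notin> spectrum A"
  shows "\<Phi> g \<circ> A = A \<circ> \<Phi> g"
proof
  fix x
  let ?r = "\<lambda>z. 1 / (\<mu> - z)" and ?L = "\<lambda>x. \<mu> *\<^sub>C x - A x"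
  note r = Hinf_resolvent_function[OF \<mu>(1)]
  have mult: "\<Phi> (\<lambda>z. g z * ?r z) = \<Phi> g \<circ> \<Phi> ?r" "\<Phi> (\<lambda>z. ?r z * g z) = \<Phi> ?r \<circ> \<Phi> g"
  proof -
    have *: "\<Phi> (\<lambda>z. p z * q z) = \<Phi> p \<circ> \<Phi> q" if "p \<in> Hinf \<Omega>" "q \<in> Hinf \<Omega>" for p q
      using \<Phi> that unfolding bounded_Hinf_calculus_def by blast
    show "\<Phi> (\<lambda>z. g z * ?r z) = \<Phi> g \<circ> \<Phi> ?r" by (rule *[OF g r])
    show "\<Phi> (\<lambda>z. ?r z * g z) = \<Phi> ?r \<circ> \<Phi> g" by (rule *[OF r g])
  qed
  have "(\<lambda>z. g z * ?r z) = (\<lambda>z. ?r z * g z)" by (simp add: mult.commute)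
  with mult have swap: "\<Phi> g \<circ> \<Phi> ?r = \<Phi> ?r \<circ> \<Phi> g" by metis
  have "\<Phi> ?r = resolvent A \<mu>"
    using \<Phi> \<mu>(1) unfolding bounded_Hinf_calculus_def by blast
  then have comm: "\<Phi> g (resolvent A \<mu> y) = resolvent A \<mu> (\<Phi> g y)" for y
    using swap by (metis comp_apply)
  have inv: "resolvent A \<mu> (?L y) = y" "?L (resolvent A \<mu> y) = y" for y
    using resolvent_inverse[OF \<mu>(2)] by (metis comp_apply id_apply)+
  have "?L (\<Phi> g x) = \<Phi> g (?L x)"
    using comm[of "?L x"] inv(1)[of x] inv(2)[of "\<Phi> g (?L x)"] by simp
  moreover have "bounded_clinear (\<Phi> g)"
    using \<Phi> g unfolding bounded_Hinf_calculus_def by blast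
  then have "\<Phi> g (?L x) = \<mu> *\<^sub>C \<Phi> g x - \<Phi> g (A x)"
    by (simp add: bounded_clinear_def linear_diff bounded_linear.linear)
  ultimately show "(\<Phi> g \<circ> A) x = (A \<circ> \<Phi> g) x" by simp
qed

end

theory Submission
  imports Defs "HOL-Complex_Analysis.Conformal_Mappings"
begin

text \<open>
  For a power-bounded \<open>T\<close> every \<open>x\<close> splits as \<open>y + (x - y)\<close> with \<open>T y = y\<close> and \<open>x - y\<close> in the closure of
  the range of \<open>I - T\<close>: reflexivity provides \<open>y\<close> as a weak cluster point of the ergodic means of \<open>x\<close>,
  and Hahn--Banach gives both properties of \<open>y\<close>. On the two summands the means converge to \<open>y\<close> and to \<open>0\<close>.

  For the powers it remains to see that \<open>T\<^sup>n (I - T) x\<close> tends to \<open>0\<close>. Power-boundedness makes the pole at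
  \<open>1\<close> simple, so \<open>z (I - T) (z - T)\<^sup>-\<^sup>1 x\<close> extends continuously to the closed annulus \<open>1 \<le> |z| \<le> 2\<close>;
  averaging it over roots of unity gives the claim, as in Rickart's proof of the spectral radius formula.

  That \<open>\<Psi>\<close> lies in \<open>H\<^sup>\<infinity>\<close> is not immediate, since an intermediate composition may take the vertex of the
  domain as a value; by the open mapping theorem this happens only if that composition is constant.
\<close>

section \<open>The Hahn--Banach theorem\<close>

text \<open>Homogeneity is asked for only as an inequality and only for \<open>c > 0\<close>, which
  is all that has to be checked for an infimum. Equality for \<open>c \<ge> 0\<close> follows by
  also scaling with \<open>inverse c\<close>.\<close>

definition sublinear :: "('a::real_vector \<Rightarrow> real) \<Rightarrow> bool"
  where "sublinear q \<longleftrightarrow>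
    (\<forall>x y. q (x + y) \<le> q x + q y) \<and> (\<forall>c>0. \<forall>x. q (c *\<^sub>R x) \<le> c * q x)"

lemma sublinear_add: "sublinear q \<Longrightarrow> q (x + y) \<le> q x + q y"
  by (simp add: sublinear_def)

lemma sublinear_zero:
  assumes "sublinear q"
  shows "q 0 = 0"
proof -
  have "q ((1/2) *\<^sub>R 0) \<le> 1/2 * q 0"
    using assms unfolding sublinear_def by (metis half_gt_zero zero_less_one)
  moreover have "q 0 \<le> q 0 + q 0"
    using sublinear_add[OF assms, of 0 0] by simp
  ultimately show ?thesis by simp
qed

lemma sublinear_scaleR:
  assumes "sublinear q" "0 \<le> c"
  shows "q (c *\<^sub>R x) = c * q x"
proof (cases "c = 0")
  case True
  then show ?thesis by (simp add: sublinear_zero[OF assms(1)])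
next
  case False
  with assms have c: "0 < c" "0 < inverse c" by auto
  have le: "\<And>d y. 0 < d \<Longrightarrow> q (d *\<^sub>R y) \<le> d * q y"
    using assms(1) by (simp add: sublinear_def)
  have "q (inverse c *\<^sub>R (c *\<^sub>R x)) \<le> inverse c * q (c *\<^sub>R x)"
    by (rule le) (fact c)
  then have "c * q x \<le> q (c *\<^sub>R x)"
    using c by (simp add: field_simps)
  with le[OF c(1), of x] show ?thesis by simp
qed

lemma sublinear_ge:
  assumes "sublinear q"
  shows "- q (- x) \<le> q x"
  using sublinear_add[OF assms, of x "- x"] sublinear_zero[OF assms] by simp

text \<open>The tilt \<open>q'\<close> is the infimum of the right-hand side over
  \<open>t \<ge> 0\<close>. It lowers \<open>q\<close> until \<open>y\<close> becomes a direction of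
  linearity: taking \<open>t = 1\<close> and \<open>x = - y\<close> gives
  \<open>q' (- y) \<le> - q y\<close>. It serves twice, to show that minimal functionals are
  additive and to prescribe a value at one point.\<close>

lemma sublinear_tilt:
  fixes q :: "'a::real_vector \<Rightarrow> real"
  assumes q: "sublinear q"
  obtains q' where "sublinear q'" "q' \<le> q" "\<And>x t. 0 \<le> t \<Longrightarrow> q' x \<le> q (x + t *\<^sub>R y) - t * q y"
proof -
  define q' where "q' = (\<lambda>x. INF t\<in>{0..}. q (x + t *\<^sub>R y) - t * q y)"
  \<comment> \<open>Subadditivity applied to \<open>t y = (x + t y) + (- x)\<close> bounds the
    family below.\<close>
  have bdd: "bdd_below ((\<lambda>t. q (x + t *\<^sub>R y) - t * q y) ` {0..})" for x
  proof (rule bdd_belowI2)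
    fix t :: real assume "t \<in> {0..}"
    then show "- q (- x) \<le> q (x + t *\<^sub>R y) - t * q y"
      using sublinear_add[OF q, of "x + t *\<^sub>R y" "- x"] sublinear_scaleR[OF q, of t y] by simp
  qed
  have low: "q' x \<le> q (x + t *\<^sub>R y) - t * q y" if "0 \<le> t" for x t
    unfolding q'_def by (rule cINF_lower[OF bdd]) (use that in auto)
  have great: "a \<le> q' x" if "\<And>t. 0 \<le> t \<Longrightarrow> a \<le> q (x + t *\<^sub>R y) - t * q y" for x a
    unfolding q'_def by (rule cINF_greatest) (use that in auto)
  have add: "q' (x + x') \<le> q' x + q' x'" for x x'
  proof -
    \<comment> \<open>The parameters add up: the infimum at \<open>x + x'\<close> is tested at
      \<open>t + s\<close>. Taking the infimum over \<open>s\<close> and then over \<open>t\<close>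
      yields subadditivity.\<close>
    have two: "q' (x + x') - (q (x + t *\<^sub>R y) - t * q y) \<le> q (x' + s *\<^sub>R y) - s * q y"
      if "0 \<le> t" "0 \<le> s" for s t
    proof -
      have "q' (x + x') \<le> q ((x + x') + (t + s) *\<^sub>R y) - (t + s) * q y"
        by (rule low) (use that in auto)
      also have "(x + x') + (t + s) *\<^sub>R y = (x + t *\<^sub>R y) + (x' + s *\<^sub>R y)"
        by (simp add: algebra_simps)
      finally show ?thesis
        using sublinear_add[OF q, of "x + t *\<^sub>R y" "x' + s *\<^sub>R y"] by (simp add: algebra_simps)
    qed
    have "q' (x + x') - (q (x + t *\<^sub>R y) - t * q y) \<le> q' x'" if "0 \<le> t" for t
      by (rule great) (rule two[OF that])
    then have "q' (x + x') - q' x' \<le> q' x"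
      by (intro great) (simp add: algebra_simps)
    then show ?thesis by simp
  qed
  have scale: "q' (c *\<^sub>R x) \<le> c * q' x" if c: "0 < c" for c x
  proof -
    have "q' (c *\<^sub>R x) / c \<le> q' x"
    proof (rule great)
      fix t :: real assume t: "0 \<le> t"
      have "q' (c *\<^sub>R x) \<le> q (c *\<^sub>R x + (c * t) *\<^sub>R y) - (c * t) * q y"
        by (rule low) (use c t in auto)
      also have "c *\<^sub>R x + (c * t) *\<^sub>R y = c *\<^sub>R (x + t *\<^sub>R y)"
        by (simp add: algebra_simps)
      also have "q (c *\<^sub>R (x + t *\<^sub>R y)) = c * q (x + t *\<^sub>R y)"
        using c by (intro sublinear_scaleR[OF q]) simp
      finally show "q' (c *\<^sub>R x) / c \<le> q (x + t *\<^sub>R y) - t * q y"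
        using c by (simp add: field_simps)
    qed
    with c show ?thesis by (simp add: field_simps)
  qed
  show ?thesis
  proof
    show "sublinear q'" using add scale by (simp add: sublinear_def)
    show "q' \<le> q" using low[of 0] by (simp add: le_fun_def)
  qed (fact low)
qed

text \<open>The pointwise infimum works. It is finite because \<open>- p (- x)\<close> bounds every
  member below at \<open>x\<close>. Subadditivity uses the chain condition: two members are both
  bounded below by the smaller of them.\<close>

lemma sublinear_chain_Inf:
  assumes C: "C \<noteq> {}" "\<And>q. q \<in> C \<Longrightarrow> sublinear q \<and> q \<le> p"
    and chain: "\<And>q r. q \<in> C \<Longrightarrow> r \<in> C \<Longrightarrow> q \<le> r \<or> r \<le> q"
  obtains u where "sublinear u" "\<And>q. q \<in> C \<Longrightarrow> u \<le> q"
proof -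
  define u where "u = (\<lambda>x. INF q\<in>C. q x)"
  have bdd: "bdd_below ((\<lambda>q. q x) ` C)" for x
  proof (rule bdd_belowI2)
    fix q assume "q \<in> C"
    then have "sublinear q" "q (- x) \<le> p (- x)" using C(2) by (auto simp: le_fun_def)
    then show "- p (- x) \<le> q x" using sublinear_ge[of q x] by linarith
  qed
  have low: "u x \<le> q x" if "q \<in> C" for x q
    unfolding u_def by (rule cINF_lower[OF bdd that])
  have great: "a \<le> u x" if "\<And>q. q \<in> C \<Longrightarrow> a \<le> q x" for a x
    unfolding u_def by (rule cINF_greatest) (use C that in auto)
  have "u (x + y) \<le> u x + u y" for x y
  proof -
    have two: "u (x + y) - q x \<le> r y" if qr: "q \<in> C" "r \<in> C" for q r
    proof -
      from chain[OF qr] obtain s where s: "s \<in> C" "s \<le> q" "s \<le> r" using qr by blast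
      have "u (x + y) \<le> s x + s y"
        using low[OF s(1), of "x + y"] sublinear_add[of s x y] C(2)[OF s(1)] by simp
      also have "\<dots> \<le> q x + r y" using s by (intro add_mono) (auto simp: le_fun_def)
      finally show ?thesis by simp
    qed
    have "u (x + y) - q x \<le> u y" if "q \<in> C" for q
      by (rule great) (rule two[OF that])
    then have "u (x + y) - u y \<le> u x"
      by (intro great) (simp add: algebra_simps)
    then show ?thesis by simp
  qed
  moreover have "u (c *\<^sub>R x) \<le> c * u x" if c: "0 < c" for c x
  proof -
    have "u (c *\<^sub>R x) / c \<le> u x"
    proof (rule great)
      fix q assume "q \<in> C"
      then have "u (c *\<^sub>R x) \<le> c * q x"
        using low[of q "c *\<^sub>R x"] C(2)[of q] sublinear_scaleR[of q c x] c by simp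
      with c show "u (c *\<^sub>R x) / c \<le> q x" by (simp add: field_simps)
    qed
    with c show ?thesis by (simp add: field_simps)
  qed
  ultimately have "sublinear u" by (simp add: sublinear_def)
  with low that show ?thesis by (simp add: le_fun_def)
qed

lemma minimal_sublinear_exists:
  assumes p: "sublinear p"
  obtains q where "sublinear q" "q \<le> p" "\<And>r. sublinear r \<Longrightarrow> r \<le> q \<Longrightarrow> r = q"
proof -
  let ?A = "{q. sublinear q \<and> q \<le> p}"
  have "\<exists>m\<in>?A. \<forall>a\<in>?A. a \<le> m \<longrightarrow> a = m"
  \<comment> \<open>The order is reversed, so the maximal element from Zorn's lemma is a minimal
    functional. The empty chain is bounded by \<open>p\<close> itself.\<close>
  proof (rule predicate_Zorn[where P = "\<lambda>a b. b \<le> a"])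
    show "partial_order_on ?A (relation_of (\<lambda>a b. b \<le> a) ?A)"
      by (rule partial_order_on_relation_ofI) auto
    fix C assume "C \<in> Chains (relation_of (\<lambda>a b. b \<le> a) ?A)"
    then have C: "\<And>q. q \<in> C \<Longrightarrow> q \<in> ?A" "\<And>q r. q \<in> C \<Longrightarrow> r \<in> C \<Longrightarrow> q \<le> r \<or> r \<le> q"
      by (auto simp: Chains_def relation_of_def)
    show "\<exists>u\<in>?A. \<forall>a\<in>C. u \<le> a"
    proof (cases "C = {}")
      case True
      then show ?thesis using p by auto
    next
      case False
      obtain u where u: "sublinear u" "\<And>q. q \<in> C \<Longrightarrow> u \<le> q"
        by (rule sublinear_chain_Inf[OF False, of p]) (use C in auto)
      with False C(1) have "u \<le> p" by (metis (mono_tags) ex_in_conv mem_Collect_eq order_trans)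
      with u show ?thesis by blast
    qed
  qed
  then show ?thesis using that by (blast intro: order_trans)
qed

text \<open>Tilting along \<open>y\<close> cannot lower a minimal functional, so
  \<open>q x \<le> q (x + y) - q y\<close>, the reverse of subadditivity. Additivity gives oddness,
  which extends homogeneity to negative scalars.\<close>

lemma minimal_sublinear_linear:
  assumes q: "sublinear q" and min: "\<And>r. sublinear r \<Longrightarrow> r \<le> q \<Longrightarrow> r = q"
  shows "linear q"
proof -
  have add: "q (x + y) = q x + q y" for x y
  proof -
    obtain q' where q': "sublinear q'" "q' \<le> q"
      "\<And>x t. 0 \<le> t \<Longrightarrow> q' x \<le> q (x + t *\<^sub>R y) - t * q y"
      using sublinear_tilt[OF q] by blast
    have "q' = q" by (rule min) (fact q')+
    then have "q x \<le> q (x + y) - q y" using q'(3)[of 1 x] by simp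
    with sublinear_add[OF q, of x y] show ?thesis by simp
  qed
  have "q (- x) = - q x" for x
    using add[of x "- x"] sublinear_zero[OF q] by simp
  then have "q (c *\<^sub>R x) = c * q x" for c x
    using sublinear_scaleR[OF q, of c x] sublinear_scaleR[OF q, of "- c" x]
    by (cases "0 \<le> c") (auto simp: minus_equation_iff)
  with add show ?thesis by (intro linearI) auto
qed

text \<open>A minimal functional below the tilt of \<open>p\<close> along \<open>x0\<close> is
  linear and satisfies \<open>f (- x0) \<le> - p x0\<close>, so it touches \<open>p\<close> at
  \<open>x0\<close>. Prescribing the value at one point takes the place of extending from a
  subspace.\<close>

theorem Hahn_Banach_sublinear:
  assumes p: "sublinear p"
  obtains f where "linear f" "f \<le> p" "f x0 = p x0"
proof -
  obtain p' where p': "sublinear p'" "p' \<le> p"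
    "\<And>x t. 0 \<le> t \<Longrightarrow> p' x \<le> p (x + t *\<^sub>R x0) - t * p x0"
    using sublinear_tilt[OF p] by blast
  obtain f where f: "sublinear f" "f \<le> p'" "\<And>r. sublinear r \<Longrightarrow> r \<le> f \<Longrightarrow> r = f"
    using minimal_sublinear_exists[OF p'(1)] by blast
  have lin: "linear f" using f minimal_sublinear_linear by blast
  have "f (- x0) \<le> p' (- x0)" using f(2) by (simp add: le_fun_def)
  also have "\<dots> \<le> - p x0" using p'(3)[of 1 "- x0"] sublinear_zero[OF p] by simp
  finally have "p x0 \<le> f x0" using linear_neg[OF lin] by simp
  moreover have "f \<le> p" using f(2) p'(2) by (rule order_trans)
  ultimately have "f x0 = p x0" by (simp add: le_fun_def antisym)
  with lin \<open>f \<le> p\<close> that show ?thesis by blast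
qed

section \<open>Complex scalars and separation of a point from a closed subspace\<close>

lemma scaleC_zero_left [simp]: "0 *\<^sub>C (x::'a::complex_banach) = 0"
  using scaleC_of_real[of 0 x] by simp

lemma scaleC_zero_right [simp]: "c *\<^sub>C (0::'a::complex_banach) = 0"
  using norm_scaleC[of c "0::'a"] by simp

lemma scaleC_one [simp]: "1 *\<^sub>C (x::'a::complex_banach) = x"
  using scaleC_of_real[of 1 x] by simp

lemma scaleC_minus_left [simp]: "(- c) *\<^sub>C (x::'a::complex_banach) = - (c *\<^sub>C x)"
  using scaleC_add_left[of c "- c" x] by (simp add: eq_neg_iff_add_eq_0 add.commute)

lemma scaleC_minus_right [simp]: "c *\<^sub>C (- x::'a::complex_banach) = - (c *\<^sub>C x)"
  using scaleC_add_right[of c x "- x"] by (simp add: eq_neg_iff_add_eq_0 add.commute)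

lemma scaleC_diff_left: "(c - d) *\<^sub>C (x::'a::complex_banach) = c *\<^sub>C x - d *\<^sub>C x"
  using scaleC_add_left[of c "- d" x] by simp

lemma scaleC_diff_right: "c *\<^sub>C (x - y::'a::complex_banach) = c *\<^sub>C x - c *\<^sub>C y"
  using scaleC_add_right[of c x "- y"] by simp

lemma scaleC_scaleR: "c *\<^sub>C (r *\<^sub>R x::'a::complex_banach) = r *\<^sub>R (c *\<^sub>C x)"
  by (metis scaleC_of_real scaleC_scaleC mult.commute)

lemma bounded_bilinear_scaleC: "bounded_bilinear (scaleC :: complex \<Rightarrow> 'a::complex_banach \<Rightarrow> 'a)"
proof
  show "(r *\<^sub>R c) *\<^sub>C x = r *\<^sub>R (c *\<^sub>C x)" for r c and x :: 'a
    by (metis scaleC_of_real scaleC_scaleC scaleR_conv_of_real)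
  show "\<exists>K. \<forall>c (x::'a). norm (c *\<^sub>C x) \<le> norm c * norm x * K"
    by (rule exI[of _ 1]) (simp add: norm_scaleC)
qed (auto simp: scaleC_add_left scaleC_add_right scaleC_scaleR)

text \<open>The distance to the subspace \<open>Y\<close> is sublinear. A real linear functional
  dominated by it and touching it at \<open>x0\<close> vanishes on \<open>Y\<close>, is positive at
  \<open>x0\<close> and is bounded by the norm; complexifying it keeps these properties in the
  required form.\<close>

theorem clinear_separation:
  fixes Y :: "'a::complex_banach set"
  assumes Y: "0 \<in> Y" "\<And>x y. x \<in> Y \<Longrightarrow> y \<in> Y \<Longrightarrow> x + y \<in> Y"
      "\<And>c x. x \<in> Y \<Longrightarrow> c *\<^sub>C x \<in> Y"
    and x0: "x0 \<notin> closure Y"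
  obtains f :: "'a \<Rightarrow> complex"
    where "bounded_clinear f" "\<And>y. y \<in> Y \<Longrightarrow> f y = 0" "f x0 \<noteq> 0"
proof -
  have ne: "Y \<noteq> {}" using Y by auto
  define p where "p = (\<lambda>x. infdist x Y)"
  have p_le: "p x \<le> norm (x - y)" if "y \<in> Y" for x y
    unfolding p_def using infdist_le[OF that, of x] by (simp add: dist_norm)
  have great: "a \<le> p x" if "\<And>y. y \<in> Y \<Longrightarrow> a \<le> norm (x - y)" for a x
    unfolding p_def infdist_notempty[OF ne]
    by (rule cINF_greatest[OF ne]) (use that in \<open>auto simp: dist_norm\<close>)
  have p_norm: "p x \<le> norm x" for x using p_le[OF Y(1), of x] by simp
  have Yscale: "r *\<^sub>R y \<in> Y" if "y \<in> Y" for r y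
    using Y(3)[OF that, of "complex_of_real r"] by (simp add: scaleC_of_real)
  have "sublinear p"
    unfolding sublinear_def
  proof (intro conjI allI impI)
    fix x x'
    have two: "p (x + x') - norm (x - y) \<le> norm (x' - y')" if "y \<in> Y" "y' \<in> Y" for y y'
      using p_le[OF Y(2)[OF that], of "x + x'"] norm_triangle_ineq[of "x - y" "x' - y'"]
      by (simp add: algebra_simps)
    have "p (x + x') - norm (x - y) \<le> p x'" if "y \<in> Y" for y
      by (rule great) (rule two[OF that])
    then have "p (x + x') - p x' \<le> p x"
      by (intro great) (simp add: algebra_simps)
    then show "p (x + x') \<le> p x + p x'" by simp
  next
    fix c :: real and x assume c: "0 < c"
    have "p (c *\<^sub>R x) / c \<le> p x"
    proof (rule great)
      fix y assume "y \<in> Y"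
      from p_le[OF Yscale[OF this, of c], of "c *\<^sub>R x"]
      have "p (c *\<^sub>R x) \<le> c * norm (x - y)"
        using c by (simp flip: scaleR_diff_right)
      with c show "p (c *\<^sub>R x) / c \<le> norm (x - y)" by (simp add: field_simps)
    qed
    with c show "p (c *\<^sub>R x) \<le> c * p x" by (simp add: field_simps)
  qed
  then obtain f where f: "linear f" "f \<le> p" "f x0 = p x0"
    using Hahn_Banach_sublinear by blast
  have px0: "p x0 > 0"
    using x0 in_closure_iff_infdist_zero[OF ne, of x0] infdist_nonneg[of x0 Y]
    by (simp add: p_def)
  have f_abs: "\<bar>f x\<bar> \<le> norm x" for x
  proof -
    have "f x \<le> p x" "f (- x) \<le> p (- x)" using f(2) by (auto simp: le_fun_def)
    then show ?thesis using p_norm[of x] p_norm[of "- x"] linear_neg[OF f(1), of x] by simp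
  qed
  have f_Y: "f y = 0" if y: "y \<in> Y" for y
  proof -
    have "f y \<le> p y" "f (- y) \<le> p (- y)" using f(2) by (auto simp: le_fun_def)
    moreover have "p y \<le> 0" "p (- y) \<le> 0"
      using p_le[OF y, of y] p_le[OF Yscale[OF y, of "- 1"], of "- y"] by auto
    ultimately show ?thesis using linear_neg[OF f(1), of y] by simp
  qed
  \<comment> \<open>The complex linear functional with real part \<open>f\<close>: the imaginary
    part is forced by \<open>g (\<i> *\<^sub>C x) = \<i> * g x\<close>.\<close>
  define g where "g = (\<lambda>x. Complex (f x) (- f (\<i> *\<^sub>C x)))"
  have add: "g (x + y) = g x + g y" for x y
    by (simp add: g_def complex_eq_iff linear_add[OF f(1)] scaleC_add_right)
  have cscale: "g (c *\<^sub>C x) = c * g x" for c x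
  proof -
    have split: "f (d *\<^sub>C y) = Re d * f y + Im d * f (\<i> *\<^sub>C y)" for d y
    proof -
      have "d *\<^sub>C y = Re d *\<^sub>R y + Im d *\<^sub>R (\<i> *\<^sub>C y)"
        using scaleC_add_left[of "complex_of_real (Re d)" "complex_of_real (Im d) * \<i>" y]
        by (simp flip: scaleC_of_real add: scaleC_scaleC complex_eq[symmetric] mult.commute)
      then show ?thesis by (simp add: linear_add[OF f(1)] linear_scale[OF f(1)])
    qed
    show ?thesis
      using split[of c x] split[of "\<i> * c" x]
      by (simp add: g_def complex_eq_iff scaleC_scaleC)
  qed
  have "bounded_linear g"
  proof (rule bounded_linear_intro)
    show "g (r *\<^sub>R x) = r *\<^sub>R g x" for r x
      using cscale[of "complex_of_real r" x] by (simp add: scaleC_of_real scaleR_conv_of_real)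
    show "norm (g x) \<le> norm x * 2" for x
    proof -
      have "norm (g x) \<le> \<bar>f x\<bar> + \<bar>f (\<i> *\<^sub>C x)\<bar>"
        using cmod_le[of "g x"] by (simp add: g_def)
      also have "\<dots> \<le> norm x + norm (\<i> *\<^sub>C x)" by (intro add_mono f_abs)
      finally show ?thesis by (simp add: norm_scaleC)
    qed
  qed (fact add)
  then have "bounded_clinear g"
    using cscale by (simp add: bounded_clinear_def scaleC_complex_def)
  moreover have "g y = 0" if "y \<in> Y" for y
    using f_Y[OF that] f_Y[OF Y(3)[OF that]] by (simp add: g_def complex_eq_iff)
  moreover have "g x0 \<noteq> 0" using px0 f(3) by (simp add: g_def complex_eq_iff)
  ultimately show ?thesis using that by blast
qed

text \<open>Separation of \<open>x - y\<close> from the zero subspace. It identifies vectors that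
  are known only through weak limits.\<close>

corollary clinear_functionals_separate:
  fixes x y :: "'a::complex_banach"
  assumes "\<And>f :: 'a \<Rightarrow> complex. bounded_clinear f \<Longrightarrow> f x = f y"
  shows "x = y"
proof (rule ccontr)
  assume "x \<noteq> y"
  then have "x - y \<notin> closure {0}" by simp
  then obtain f :: "'a \<Rightarrow> complex" where f: "bounded_clinear f" "f (x - y) \<noteq> 0"
    by (rule clinear_separation[of "{0}", rotated 3]) auto
  then show False
    using assms[OF f(1)] by (simp add: bounded_clinear_def linear_diff bounded_linear.linear)
qed

section \<open>The mean ergodic theorem in reflexive spaces\<close>

lemma bounded_clinear_add: "bounded_clinear f \<Longrightarrow> f (x + y) = f x + f y"
  and bounded_clinear_diff: "bounded_clinear f \<Longrightarrow> f (x - y) = f x - f y"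
  and bounded_clinear_scaleC: "bounded_clinear f \<Longrightarrow> f (c *\<^sub>C x) = c *\<^sub>C f x"
  and bounded_clinear_scaleR: "bounded_clinear f \<Longrightarrow> f (r *\<^sub>R x) = r *\<^sub>R f x"
  and bounded_clinear_sum: "bounded_clinear f \<Longrightarrow> f (\<Sum>i\<in>I. u i) = (\<Sum>i\<in>I. f (u i))"
  by (simp_all add: bounded_clinear_def linear_add linear_diff linear_cmul linear_sum
      bounded_linear.linear)

lemma bounded_clinear_norm_le:
  "bounded_clinear f \<Longrightarrow> norm (f x) \<le> onorm f * norm x"
  by (simp add: bounded_clinear_def onorm)

lemma bounded_clinear_tendsto:
  "bounded_clinear f \<Longrightarrow> (u \<longlongrightarrow> l) F \<Longrightarrow> ((\<lambda>i. f (u i)) \<longlongrightarrow> f l) F"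
  by (simp add: bounded_clinear_def bounded_linear.tendsto)

lemma bounded_clinearI:
  fixes f :: "'a::complex_banach \<Rightarrow> 'b::complex_banach"
  assumes "\<And>x y. f (x + y) = f x + f y" "\<And>c x. f (c *\<^sub>C x) = c *\<^sub>C f x"
    "\<And>x. norm (f x) \<le> B * norm x"
  shows "bounded_clinear f"
proof -
  have "f (r *\<^sub>R x) = r *\<^sub>R f x" for r x
    using assms(2)[of "complex_of_real r" x] by (simp add: scaleC_of_real)
  then have "bounded_linear f"
    by (intro bounded_linear_intro[where K = B]) (use assms in \<open>auto simp: mult.commute\<close>)
  with assms(2) show ?thesis by (simp add: bounded_clinear_def)
qed

lemma bounded_clinear_compose:
  "bounded_clinear f \<Longrightarrow> bounded_clinear g \<Longrightarrow> bounded_clinear (\<lambda>x. f (g x))"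
  by (simp add: bounded_clinear_def bounded_linear_compose)

lemma bounded_clinear_funpow:
  fixes T :: "'a::complex_banach \<Rightarrow> 'a"
  assumes "bounded_clinear T"
  shows "bounded_clinear (T ^^ n)"
proof (induction n)
  case 0
  then show ?case by (simp add: bounded_clinear_def bounded_linear_ident id_def)
next
  case (Suc n)
  then show ?case using bounded_clinear_compose[OF assms Suc] by (simp add: comp_def)
qed

text \<open>The uniform bound \<open>M\<close> lets convergence pass from \<open>Y\<close> to its
  closure. It is applied to the ergodic means and to the powers of \<open>T\<close>.\<close>

lemma tendsto_zero_on_closure:
  fixes S :: "nat \<Rightarrow> 'a::real_normed_vector \<Rightarrow> 'b::real_normed_vector"
  assumes diff: "\<And>n x y. S n (x - y) = S n x - S n y"
    and bound: "\<And>n x. norm (S n x) \<le> M * norm x"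
    and Y: "\<And>y. y \<in> Y \<Longrightarrow> (\<lambda>n. S n y) \<longlonglongrightarrow> 0"
    and x: "x \<in> closure Y"
  shows "(\<lambda>n. S n x) \<longlonglongrightarrow> 0"
proof (rule LIMSEQ_I)
  fix e :: real assume e: "0 < e"
  \<comment> \<open>Chosen so that replacing \<open>x\<close> by \<open>y\<close> costs less than
    \<open>e / 2\<close>; \<open>\<bar>M\<bar> + 1\<close> keeps the divisor positive for every real
    \<open>M\<close>.\<close>
  define d where "d = e / (2 * (\<bar>M\<bar> + 1))"
  have d: "0 < d" using e by (simp add: d_def add_nonneg_pos)
  then obtain y where y: "y \<in> Y" "dist y x < d"
    using x by (auto simp: closure_approachable)
  have small: "norm (S n (x - y)) < e / 2" for n
  proof -
    have "norm (S n (x - y)) \<le> M * norm (x - y)" by (rule bound)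
    also have "\<dots> \<le> (\<bar>M\<bar> + 1) * norm (x - y)" by (intro mult_right_mono) auto
    also have "\<dots> < (\<bar>M\<bar> + 1) * d"
      using y(2) by (intro mult_strict_left_mono) (auto simp: dist_norm norm_minus_commute)
    also have "\<dots> = e / 2" by (simp add: d_def field_simps)
    finally show ?thesis .
  qed
  obtain N where N: "\<And>n. n \<ge> N \<Longrightarrow> norm (S n y) < e / 2"
    using LIMSEQ_D[OF Y[OF y(1)], of "e / 2"] e by auto
  have "norm (S n x - 0) < e" if "n \<ge> N" for n
    using small[of n] N[OF that] norm_triangle_ineq[of "S n (x - y)" "S n y"]
    by (simp add: diff)
  then show "\<exists>N. \<forall>n\<ge>N. norm (S n x - 0) < e" by blast
qed

text \<open>A bounded sequence, viewed in the bidual, has a pointwise cluster point by Tychonoff's theorem;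
  reflexivity realises this cluster point as a vector.\<close>

lemma reflexive_bounded_weak_cluster:
  fixes u :: "nat \<Rightarrow> 'a::complex_banach"
  assumes refl: "reflexive_space TYPE('a)" and B: "\<And>n. norm (u n) \<le> B"
  shows "\<exists>F y. F \<noteq> bot \<and> F \<le> sequentially \<and>
    (\<forall>f :: 'a \<Rightarrow> complex. bounded_clinear f \<longrightarrow> ((\<lambda>n. f (u n)) \<longlongrightarrow> f y) F)"
proof -
  \<comment> \<open>\<open>G n\<close> is evaluation at \<open>u n\<close>. Arguments that are not
    bounded functionals get the value \<open>0\<close>, so \<open>G n\<close> lies in a product of
    compact discs whose radius is \<open>0\<close> at such arguments.\<close>
  define G where "G = (\<lambda>n (f :: 'a \<Rightarrow> complex). if bounded_clinear f then f (u n) else 0)"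
  define R where "R = (\<lambda>f :: 'a \<Rightarrow> complex. if bounded_clinear f then B * onorm f else 0)"
  define U where "U = (Pi\<^sub>E UNIV (\<lambda>f. cball (0::complex) (R f)))"
  have "compactin (product_topology (\<lambda>i. euclidean) UNIV) U"
    unfolding U_def compactin_PiE by auto
  then have "compact U"
    by (simp add: euclidean_product_topology)
  have GU: "G n \<in> U" for n
  proof -
    have "cmod (f (u n)) \<le> B * onorm f" if "bounded_clinear f" for f :: "'a \<Rightarrow> complex"
    proof -
      have "onorm f \<ge> 0" using that by (simp add: bounded_clinear_def onorm_pos_le)
      then have "onorm f * norm (u n) \<le> onorm f * B" using B by (intro mult_left_mono)
      with bounded_clinear_norm_le[OF that, of "u n"] show ?thesis by (simp add: mult.commute)
    qed
    then show ?thesis by (auto simp: U_def G_def R_def)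
  qed
  have "filtermap G sequentially \<noteq> bot" by (simp add: filtermap_bot_iff)
  moreover have "eventually (\<lambda>z. z \<in> U) (filtermap G sequentially)"
    using GU by (simp add: eventually_filtermap)
  ultimately obtain g where g: "g \<in> U" "inf (nhds g) (filtermap G sequentially) \<noteq> bot"
    using \<open>compact U\<close> unfolding compact_filter by blast
  \<comment> \<open>Pulling the neighbourhoods of the cluster point back along \<open>G\<close>
    gives a filter on the indices, finer than \<open>sequentially\<close>, along which
    \<open>G n\<close> tends to \<open>g\<close>. It plays the role of a convergent subnet.\<close>
  define F where "F = inf (filtercomap G (nhds g)) sequentially"
  have "F \<noteq> bot"
  proof
    assume "F = bot"
    then have "eventually (\<lambda>_. False) F" by simp
    then obtain P Q where PQ: "eventually P (filtercomap G (nhds g))" "eventually Q sequentially"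
      "\<And>n. P n \<Longrightarrow> Q n \<Longrightarrow> False"
      unfolding F_def eventually_inf by blast
    from PQ(1) obtain P' where P': "eventually P' (nhds g)" "\<And>n. P' (G n) \<Longrightarrow> P n"
      unfolding eventually_filtercomap by blast
    have "eventually (\<lambda>z. \<not> P' z) (filtermap G sequentially)"
      unfolding eventually_filtermap using PQ(2) by eventually_elim (use PQ(3) P'(2) in blast)
    then have "eventually (\<lambda>_. False) (inf (nhds g) (filtermap G sequentially))"
      unfolding eventually_inf using P'(1) by blast
    with g(2) show False by (simp add: eventually_False)
  qed
  have "filterlim G (nhds g) F"
    unfolding F_def filterlim_def
    by (meson filtermap_filtercomap filtermap_mono inf_le1 order_trans)
  then have tend: "((\<lambda>n. G n f) \<longlongrightarrow> g f) F" for f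
    by (rule continuous_on_tendsto_compose[OF continuous_on_product_coordinates]) auto
  then have lim: "((\<lambda>n. f (u n)) \<longlongrightarrow> g f) F" if "bounded_clinear f" for f
    using that tend[of f] by (simp add: G_def)
  have add: "g (\<lambda>x. f x + h x) = g f + g h" if "bounded_clinear f" "bounded_clinear h" for f h
  proof -
    have "bounded_clinear (\<lambda>x. f x + h x)"
      using that by (simp add: bounded_clinear_def bounded_linear_add scaleC_add_right)
    from tendsto_unique[OF \<open>F \<noteq> bot\<close> lim[OF this] tendsto_add[OF lim lim]] that show ?thesis by simp
  qed
  have scale: "g (\<lambda>x. c * f x) = c * g f" if "bounded_clinear f" for c f
  proof -
    have "bounded_clinear (\<lambda>x. c * f x)"
      using that by (simp add: bounded_clinear_def bounded_linear_const_mult scaleC_complex_def)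
    from tendsto_unique[OF \<open>F \<noteq> bot\<close> lim[OF this] tendsto_mult[OF tendsto_const lim]] that
    show ?thesis by simp
  qed
  have bound: "cmod (g f) \<le> B * onorm f" if "bounded_clinear f" for f
    using g(1) that by (auto simp: U_def R_def PiE_iff dest: spec[of _ f])
  have "\<exists>y. \<forall>f. bounded_clinear f \<longrightarrow> g f = f y"
    using refl add scale bound unfolding reflexive_space_def by blast
  then obtain y where "\<And>f. bounded_clinear f \<Longrightarrow> g f = f y" by blast
  with lim have "((\<lambda>n. f (u n)) \<longlongrightarrow> f y) F" if "bounded_clinear f" for f :: "'a \<Rightarrow> complex"
    using that by metis
  moreover have "F \<le> sequentially" by (simp add: F_def)
  ultimately show ?thesis using \<open>F \<noteq> bot\<close> by blast
qed

section \<open>Ergodic means of a power-bounded operator\<close>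

locale power_bounded_operator =
  fixes T :: "'a::complex_banach \<Rightarrow> 'a" and M :: real
  assumes clinear: "bounded_clinear T"
    and M_nonneg: "0 \<le> M"
    and power_le: "norm ((T ^^ n) x) \<le> M * norm x"
begin

lemmas clinear_power = bounded_clinear_funpow[OF clinear]

lemma power_diff: "(T ^^ n) (x - y) = (T ^^ n) x - (T ^^ n) y"
  by (rule bounded_clinear_diff[OF clinear_power])

lemma power_fixed: "T x = x \<Longrightarrow> (T ^^ n) x = x"
  by (induction n) auto

lemma power_commute: "(T ^^ n) (T x) = T ((T ^^ n) x)"
  by (simp add: funpow_swap1)

lemma mean_diff: "ergodic_mean T N (x - y) = ergodic_mean T N x - ergodic_mean T N y"
  by (simp add: ergodic_mean_def power_diff sum_subtractf scaleR_diff_right)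

lemma mean_add: "ergodic_mean T N (x + y) = ergodic_mean T N x + ergodic_mean T N y"
  by (simp add: ergodic_mean_def bounded_clinear_add[OF clinear_power] sum.distrib scaleR_add_right)

lemma mean_scaleC: "ergodic_mean T N (c *\<^sub>C x) = c *\<^sub>C ergodic_mean T N x"
  by (simp add: ergodic_mean_def bounded_clinear_scaleC[OF clinear_power] scaleC_scaleR
      bounded_bilinear.sum_right[OF bounded_bilinear_scaleC])

lemma mean_norm_le: "norm (ergodic_mean T N x) \<le> M * norm x"
proof (cases "N = 0")
  case True
  then show ?thesis using M_nonneg by (simp add: ergodic_mean_def)
next
  case False
  have "norm (\<Sum>n<N. (T ^^ n) x) \<le> (\<Sum>n<N. M * norm x)"
    by (rule sum_norm_le) (rule power_le)
  with False show ?thesis by (simp add: ergodic_mean_def field_simps)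
qed

lemma mean_fixed:
  assumes "T x = x"
  shows "(\<lambda>N. ergodic_mean T N x) \<longlonglongrightarrow> x"
proof (rule Lim_transform_eventually[OF tendsto_const])
  show "eventually (\<lambda>N. x = ergodic_mean T N x) sequentially"
    using eventually_gt_at_top[of 0]
    by eventually_elim
       (simp add: ergodic_mean_def power_fixed[OF assms] scaleR_conv_of_real sum_constant_scaleR)
qed

lemma T_mean: "T (ergodic_mean T N x) = ergodic_mean T N (T x)"
  by (simp add: ergodic_mean_def bounded_clinear_scaleR[OF clinear] bounded_clinear_sum[OF clinear]
      power_commute)

text \<open>The sum telescopes to \<open>x - (T ^^ N) x\<close>, which stays bounded while it is
  divided by \<open>N\<close>.\<close>

lemma mean_coboundary: "(\<lambda>N. ergodic_mean T N (x - T x)) \<longlonglongrightarrow> 0"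
proof -
  have eq: "ergodic_mean T N (x - T x) = (1 / real N) *\<^sub>R (x - (T ^^ N) x)" for N
  proof -
    have "(\<Sum>n<N. (T ^^ n) (x - T x)) = (\<Sum>n<N. (T ^^ n) x - (T ^^ Suc n) x)"
      by (simp add: power_diff power_commute)
    also have "\<dots> = x - (T ^^ N) x"
      by (subst sum_lessThan_telescope') simp
    finally show ?thesis by (simp add: ergodic_mean_def)
  qed
  \<comment> \<open>At \<open>N = 0\<close> both sides vanish, since
    \<open>1 / 0 = 0\<close>.\<close>
  have "norm (ergodic_mean T N (x - T x)) \<le> (norm x + M * norm x) * (1 / real N)" for N
  proof -
    have "norm (x - (T ^^ N) x) \<le> norm x + M * norm x"
      using norm_triangle_ineq4[of x "(T ^^ N) x"] power_le[of N x] by linarith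
    then show ?thesis by (simp add: eq divide_right_mono)
  qed
  moreover have "(\<lambda>N. (norm x + M * norm x) * (1 / real N)) \<longlonglongrightarrow> 0"
    using tendsto_mult[OF tendsto_const[of "norm x + M * norm x"] lim_1_over_n] by simp
  ultimately show ?thesis
    by (rule Lim_null_comparison[OF always_eventually, OF allI])
qed

abbreviation coboundaries :: "'a set"
  where "coboundaries \<equiv> range (\<lambda>x. x - T x)"

lemma mean_closure_coboundaries:
  "x \<in> closure coboundaries \<Longrightarrow> (\<lambda>N. ergodic_mean T N x) \<longlonglongrightarrow> 0"
  by (rule tendsto_zero_on_closure[OF mean_diff mean_norm_le, rotated]) (use mean_coboundary in auto)

text \<open>The cluster point \<open>y\<close> is fixed because the means of \<open>x - T x\<close>
  tend to \<open>0\<close>, so the means of \<open>x\<close> and their images under \<open>T\<close>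
  have the same limit along \<open>F\<close>. If \<open>x - y\<close> were outside the closure, a
  functional vanishing on coboundaries would be invariant under \<open>T\<close>, hence equal to
  \<open>f x\<close> on all means of \<open>x\<close>, and would not distinguish \<open>x\<close>
  from \<open>y\<close>.\<close>

lemma ergodic_decomposition:
  assumes refl: "reflexive_space TYPE('a)"
  obtains y where "T y = y" "x - y \<in> closure coboundaries"
proof -
  obtain F y where F: "F \<noteq> bot" "F \<le> sequentially"
    and y: "\<And>f :: 'a \<Rightarrow> complex. bounded_clinear f \<Longrightarrow>
      ((\<lambda>n. f (ergodic_mean T n x)) \<longlongrightarrow> f y) F"
    using reflexive_bounded_weak_cluster[where u = "\<lambda>n. ergodic_mean T n x", OF refl mean_norm_le]
    by metis
  have "T y = y"
  proof (rule clinear_functionals_separate)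
    fix f :: "'a \<Rightarrow> complex" assume f: "bounded_clinear f"
    have "(\<lambda>n. f (ergodic_mean T n (x - T x))) \<longlonglongrightarrow> f 0"
      by (rule bounded_clinear_tendsto[OF f mean_coboundary])
    then have "((\<lambda>n. f (ergodic_mean T n (x - T x))) \<longlongrightarrow> f 0) F"
      using F(2) tendsto_mono by blast
    from tendsto_diff[OF y[OF f] this]
    have "((\<lambda>n. f (T (ergodic_mean T n x))) \<longlongrightarrow> f y) F"
      using bounded_clinear_diff[OF f, of 0 0]
      by (simp add: mean_diff T_mean bounded_clinear_diff[OF f])
    moreover have "((\<lambda>n. f (T (ergodic_mean T n x))) \<longlongrightarrow> f (T y)) F"
      by (rule y) (rule bounded_clinear_compose[OF f clinear])
    ultimately show "f (T y) = f y" using tendsto_unique[OF F(1)] by blast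
  qed
  moreover have "x - y \<in> closure coboundaries"
  proof (rule ccontr)
    assume "x - y \<notin> closure coboundaries"
    then obtain f :: "'a \<Rightarrow> complex"
      where f: "bounded_clinear f" "\<And>z. z \<in> coboundaries \<Longrightarrow> f z = 0" "f (x - y) \<noteq> 0"
    proof (rule clinear_separation[rotated 3])
      show "0 \<in> coboundaries"
        using bounded_clinear_diff[OF clinear, of 0 0] by (auto intro!: image_eqI[of _ _ 0])
      show "v + w \<in> coboundaries" if "v \<in> coboundaries" "w \<in> coboundaries" for v w
      proof -
        from that obtain a b where "v = a - T a" "w = b - T b" by blast
        then have "v + w = (a + b) - T (a + b)" by (simp add: bounded_clinear_add[OF clinear])
        then show ?thesis by blast
      qed
      show "c *\<^sub>C v \<in> coboundaries" if "v \<in> coboundaries" for c v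
      proof -
        from that obtain a where "v = a - T a" by blast
        then have "c *\<^sub>C v = c *\<^sub>C a - T (c *\<^sub>C a)"
          by (simp add: bounded_clinear_scaleC[OF clinear] scaleC_diff_right)
        then show ?thesis by blast
      qed
    qed blast
    have invariant: "f ((T ^^ n) x) = f x" for n
    proof (induction n)
      case (Suc n)
      have "f ((T ^^ n) x - T ((T ^^ n) x)) = 0" by (rule f(2)) blast
      with Suc show ?case by (simp add: bounded_clinear_diff[OF f(1)])
    qed simp
    have "f (ergodic_mean T n x) = f x" if "0 < n" for n
      using that by (simp add: ergodic_mean_def bounded_clinear_scaleR[OF f(1)]
          bounded_clinear_sum[OF f(1)] invariant scaleR_conv_of_real)
    then have "(\<lambda>n. f (ergodic_mean T n x)) \<longlonglongrightarrow> f x"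
      by (intro Lim_transform_eventually[OF tendsto_const] eventually_mono[OF eventually_gt_at_top[of 0]])
         simp
    then have "((\<lambda>n. f (ergodic_mean T n x)) \<longlongrightarrow> f x) F" using F(2) tendsto_mono by blast
    then have "f x = f y" using tendsto_unique[OF F(1) _ y[OF f(1)]] by blast
    with f(3) show False by (simp add: bounded_clinear_diff[OF f(1)])
  qed
  ultimately show ?thesis using that by blast
qed

text \<open>Choosing the fixed part of each \<open>x\<close> gives \<open>P\<close>; linearity and
  the bound \<open>M\<close> come from \<open>P x\<close> being the limit of the means. The last
  conclusion is kept for the convergence of powers, which is proved on the same closure.\<close>

theorem mean_ergodic:
  assumes refl: "reflexive_space TYPE('a)"
  obtains P where "bounded_clinear P" "strong_limit (ergodic_mean T) P"
    "\<And>x. T (P x) = P x" "\<And>x. P (T x) = P x" "\<And>x. P x = x \<longleftrightarrow> T x = x"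
    "\<And>x. x - P x \<in> closure coboundaries"
proof -
  have "\<forall>x. \<exists>y. T y = y \<and> x - y \<in> closure coboundaries"
    using ergodic_decomposition[OF refl] by metis
  then obtain P where P: "\<And>x. T (P x) = P x" "\<And>x. x - P x \<in> closure coboundaries"
    by metis
  \<comment> \<open>On \<open>x - P x\<close> the means tend to \<open>0\<close>; on the fixed
    vector \<open>P x\<close> they are constant for positive \<open>N\<close>.\<close>
  have lim: "(\<lambda>N. ergodic_mean T N x) \<longlonglongrightarrow> P x" for x
    using tendsto_add[OF mean_closure_coboundaries[OF P(2)] mean_fixed[OF P(1)], of x x]
    by (simp add: mean_diff)
  have uniq: "a = P x" if "(\<lambda>N. ergodic_mean T N x) \<longlonglongrightarrow> a" for a x
    using LIMSEQ_unique[OF that lim] .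
  show ?thesis
  proof
    show "bounded_clinear P"
    proof (rule bounded_clinearI)
      show "P (x + y) = P x + P y" for x y
        using tendsto_add[OF lim lim, of x y] uniq[of "x + y"] by (simp add: mean_add)
      show "P (c *\<^sub>C x) = c *\<^sub>C P x" for c x
        using bounded_bilinear.tendsto[OF bounded_bilinear_scaleC tendsto_const lim, of c x]
          uniq[of "c *\<^sub>C x"] by (simp add: mean_scaleC)
      show "norm (P x) \<le> M * norm x" for x
        by (rule Lim_norm_ubound[OF _ lim]) (auto simp: mean_norm_le)
    qed
    show "strong_limit (ergodic_mean T) P" by (simp add: strong_limit_def lim)
    show "P (T x) = P x" for x
      using bounded_clinear_tendsto[OF clinear lim, of x] uniq[of "T x" "T (P x)"] P(1)[of x]
      by (simp add: T_mean)
    show "P x = x \<longleftrightarrow> T x = x" for x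
      using P(1)[of x] uniq[OF mean_fixed, of x] by auto
  qed (fact P)+
qed

end

section \<open>Convergence of powers\<close>

text \<open>Multiplication by a primitive root \<open>\<omega>\<close> permutes the roots, so the
  sum is unchanged by the factor \<open>\<omega> ^ m\<close>, which differs from \<open>1\<close> in
  the stated range of \<open>m\<close>.\<close>

lemma sum_powers_roots_unity:
  fixes m N :: nat
  assumes m: "0 < m" "m < N"
  shows "(\<Sum>w | w ^ N = 1. (w::complex) ^ m) = 0"
proof -
  define \<omega> where "\<omega> = cis (2 * pi / real N)"
  have "0 < real N" using m by simp
  then have "real N * (2 * pi / real N) = 2 * pi" by simp
  then have "\<omega> ^ N = 1" by (simp only: \<omega>_def Complex.DeMoivre cis_2pi)
  have "\<omega> ^ m \<noteq> 1"
  proof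
    assume "\<omega> ^ m = 1"
    then have "cis (2 * pi * real m / real N) = cis (2 * pi * real 0 / real N)"
      by (simp add: \<omega>_def Complex.DeMoivre mult_ac)
    moreover have "inj_on (\<lambda>k. cis (2 * pi * real k / real N)) {..<N}"
      using Complex.bij_betw_roots_unity[of N] m by (auto simp: bij_betw_def)
    ultimately show False using m by (auto dest!: inj_onD[of _ _ m 0])
  qed
  have "\<omega> \<noteq> 0" by (simp add: \<omega>_def)
  have "bij_betw ((*) \<omega>) {w. w ^ N = 1} {w. w ^ N = 1}"
    by (rule bij_betwI[of _ _ _ "(*) (inverse \<omega>)"])
       (use \<open>\<omega> ^ N = 1\<close> \<open>\<omega> \<noteq> 0\<close> in \<open>auto simp: power_mult_distrib power_inverse\<close>)
  from sum.reindex_bij_betw[OF this, of "\<lambda>w. w ^ m"]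
  have "\<omega> ^ m * (\<Sum>w | w ^ N = 1. w ^ m) = (\<Sum>w | w ^ N = 1. w ^ m)"
    by (simp add: power_mult_distrib sum_distrib_left)
  with \<open>\<omega> ^ m \<noteq> 1\<close> show ?thesis by simp
qed

section \<open>Continuity of the resolvent and limits at the centre of a power series\<close>

lemma resolvent_clinear:
  assumes "z \<notin> spectrum T"
  shows "bounded_clinear (resolvent T z)"
proof -
  obtain S where S: "bounded_clinear S" "S \<circ> (\<lambda>x. z *\<^sub>C x - T x) = id"
      "(\<lambda>x. z *\<^sub>C x - T x) \<circ> S = id"
    using assms by (auto simp: spectrum_def)
  then have "resolvent T z = S"
    unfolding resolvent_def by (metis inv_unique_comp)
  with S show ?thesis by simp
qed

lemma resolvent_left: "z \<notin> spectrum T \<Longrightarrow> resolvent T z (z *\<^sub>C x - T x) = x"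
  and resolvent_right: "z \<notin> spectrum T \<Longrightarrow> z *\<^sub>C resolvent T z x - T (resolvent T z x) = x"
  using resolvent_inverse[of z T] by (simp_all add: fun_eq_iff)

text \<open>With \<open>u = resolvent T w x\<close> the resolvent equation reads
  \<open>u - ?R x = - ((w - z) *\<^sub>C ?R u)\<close>. For \<open>w\<close> close to
  \<open>z\<close> the part of the right side that contains \<open>u - ?R x\<close> is absorbed on
  the left, leaving a bound linear in \<open>norm (w - z)\<close>.\<close>

lemma continuous_on_resolvent:
  fixes T :: "'a::complex_banach \<Rightarrow> 'a"
  shows "continuous_on (- spectrum T) (\<lambda>z. resolvent T z x)"
  unfolding continuous_on_def
proof
  fix z assume "z \<in> - spectrum T"
  then have z: "z \<notin> spectrum T" by simp
  let ?R = "resolvent T z"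
  note R = resolvent_clinear[OF z]
  define C where "C = onorm ?R"
  have C: "0 \<le> C" using R by (simp add: C_def bounded_clinear_def onorm_pos_le)
  have near: "norm (resolvent T w x - ?R x) \<le> 2 * C * norm (?R x) * norm (w - z)"
    \<comment> \<open>This radius makes \<open>norm (w - z) * C \<le> 1 / 2\<close>; adding
      \<open>1\<close> covers \<open>C = 0\<close>.\<close>
    if w: "w \<notin> spectrum T" "norm (w - z) < 1 / (2 * (C + 1))" for w
  proof -
    define u where "u = resolvent T w x"
    have "w *\<^sub>C u - T u = x" unfolding u_def by (rule resolvent_right[OF w(1)])
    then have "z *\<^sub>C u - T u = x - (w - z) *\<^sub>C u" by (auto simp: scaleC_diff_left)
    then have "u = ?R (x - (w - z) *\<^sub>C u)" using resolvent_left[OF z, of u] by simp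
    then have "u = ?R x - (w - z) *\<^sub>C ?R u"
      by (simp add: bounded_clinear_diff[OF R] bounded_clinear_scaleC[OF R])
    then have diff: "u - ?R x = - ((w - z) *\<^sub>C ?R u)" by (simp add: algebra_simps)
    have le: "norm (u - ?R x) \<le> norm (w - z) * (C * norm u)"
      unfolding diff using bounded_clinear_norm_le[OF R, of u]
      by (simp add: norm_scaleC C_def mult_left_mono)
    have half: "norm (w - z) * C \<le> 1 / 2"
    proof -
      have "norm (w - z) * C \<le> 1 / (2 * (C + 1)) * C"
        using w(2) C by (intro mult_right_mono) auto
      also have "\<dots> \<le> 1 / 2" using C by (simp add: field_simps)
      finally show ?thesis .
    qed
    have "norm u \<le> norm (u - ?R x) + norm (?R x)"
      using norm_triangle_ineq[of "u - ?R x" "?R x"] by simp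
    then have "norm (w - z) * C * norm u \<le> norm (w - z) * C * (norm (u - ?R x) + norm (?R x))"
      using C by (intro mult_left_mono) auto
    moreover have "norm (w - z) * C * norm (u - ?R x) \<le> 1 / 2 * norm (u - ?R x)"
      by (intro mult_right_mono half) auto
    ultimately have "norm (u - ?R x) \<le> 1 / 2 * norm (u - ?R x) + norm (w - z) * C * norm (?R x)"
      using le by (simp add: algebra_simps)
    then show ?thesis by (simp add: u_def algebra_simps)
  qed
  have "((\<lambda>w. resolvent T w x - ?R x) \<longlongrightarrow> 0) (at z within - spectrum T)"
  proof (rule Lim_null_comparison)
    show "\<forall>\<^sub>F w in at z within - spectrum T.
        norm (resolvent T w x - ?R x) \<le> 2 * C * norm (?R x) * norm (w - z)"
      unfolding eventually_at
      by (rule exI[of _ "1 / (2 * (C + 1))"])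
         (use near C in \<open>auto simp: dist_norm add_nonneg_pos\<close>)
    have "((\<lambda>w. 2 * C * norm (?R x) * norm (w - z)) \<longlongrightarrow> 2 * C * norm (?R x) * norm (z - z))
        (at z within - spectrum T)"
      by (intro tendsto_intros)
    then show "((\<lambda>w. 2 * C * norm (?R x) * norm (w - z)) \<longlongrightarrow> 0) (at z within - spectrum T)"
      by simp
  qed
  then show "((\<lambda>w. resolvent T w x) \<longlongrightarrow> ?R x) (at z within - spectrum T)"
    by (simp add: LIM_zero_iff)
qed

text \<open>Convergence at one point at distance \<open>\<rho>\<close> bounds
  \<open>\<rho> ^ n * norm (c n)\<close>. Within \<open>\<rho> / 2\<close> the tail after
  \<open>c 0\<close> is then dominated by a geometric series of ratio below \<open>1 / 2\<close>,
  hence is of order \<open>norm (z - a)\<close>.\<close>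

lemma power_series_tendsto_at_centre:
  fixes c :: "nat \<Rightarrow> 'a::complex_banach"
  assumes r: "0 < r"
    and sums: "\<And>z. 0 < dist z a \<Longrightarrow> dist z a < r \<Longrightarrow> (\<lambda>n. (z - a) ^ n *\<^sub>C c n) sums G z"
  shows "(G \<longlongrightarrow> c 0) (at a)"
proof -
  define \<rho> where "\<rho> = r / 2"
  have \<rho>: "0 < \<rho>" "\<rho> < r" using r by (auto simp: \<rho>_def)
  have "(\<lambda>n. (a + of_real \<rho> - a) ^ n *\<^sub>C c n) sums G (a + of_real \<rho>)"
    by (rule sums) (use \<rho> in \<open>auto simp: dist_norm\<close>)
  then have "Bseq (\<lambda>n. (a + of_real \<rho> - a) ^ n *\<^sub>C c n)"
    by (intro convergent_imp_Bseq convergentI[where L = 0] summable_LIMSEQ_zero sums_summable)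
  then obtain B where B: "0 < B" "\<And>n. \<rho> ^ n * norm (c n) \<le> B"
    using \<rho> by (auto simp: Bseq_def norm_scaleC norm_power)
  have near: "norm (G z - c 0) \<le> 2 * B / \<rho> * norm (z - a)"
    if z: "z \<noteq> a" "norm (z - a) < \<rho> / 2" for z
  proof -
    define q where "q = norm (z - a) / \<rho>"
    have q: "0 \<le> q" "q < 1 / 2" using z \<rho> by (auto simp: q_def field_simps)
    have "(\<lambda>n. (z - a) ^ n *\<^sub>C c n) sums G z"
      by (rule sums) (use z \<rho> in \<open>auto simp: dist_norm\<close>)
    then have tail: "(\<lambda>n. (z - a) ^ Suc n *\<^sub>C c (Suc n)) sums (G z - c 0)"
      by (subst sums_Suc_iff) simp
    have le: "norm ((z - a) ^ n *\<^sub>C c n) \<le> B * q ^ n" for n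
    proof -
      have "norm ((z - a) ^ n *\<^sub>C c n) = q ^ n * (\<rho> ^ n * norm (c n))"
        using \<rho> by (simp add: q_def norm_scaleC norm_power power_divide)
      also have "\<dots> \<le> q ^ n * B" using B q by (intro mult_left_mono) auto
      finally show ?thesis by (simp add: mult.commute)
    qed
    have geo: "(\<lambda>n. B * q ^ Suc n) sums (B * q * (1 / (1 - q)))"
      using sums_mult[OF geometric_sums[of q], of "B * q"] q by (simp add: mult_ac)
    have sn: "summable (\<lambda>n. norm ((z - a) ^ Suc n *\<^sub>C c (Suc n)))"
      by (rule summable_comparison_test[OF exI, OF allI, OF impI, OF _ sums_summable[OF geo]])
         (simp only: real_norm_def abs_norm_cancel le)
    have "norm (G z - c 0) \<le> (\<Sum>n. norm ((z - a) ^ Suc n *\<^sub>C c (Suc n)))"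
      using summable_norm[OF sn] tail by (simp add: sums_iff)
    also have "\<dots> \<le> B * q * (1 / (1 - q))"
      using suminf_le[OF le sn sums_summable[OF geo]] geo by (simp add: sums_iff)
    also have "\<dots> \<le> B * q * 2"
      using q B by (intro mult_left_mono) (auto simp: field_simps)
    finally show ?thesis by (simp add: q_def mult_ac)
  qed
  have "((\<lambda>z. G z - c 0) \<longlongrightarrow> 0) (at a)"
  proof (rule Lim_null_comparison)
    show "\<forall>\<^sub>F z in at a. norm (G z - c 0) \<le> 2 * B / \<rho> * norm (z - a)"
      unfolding eventually_at
      by (rule exI[of _ "\<rho> / 2"]) (use near \<rho> in \<open>auto simp: dist_norm\<close>)
    have "((\<lambda>z. 2 * B / \<rho> * norm (z - a)) \<longlongrightarrow> 2 * B / \<rho> * norm (a - a)) (at a)"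
      by (intro tendsto_intros)
    then show "((\<lambda>z. 2 * B / \<rho> * norm (z - a)) \<longlongrightarrow> 0) (at a)" by simp
  qed
  then show ?thesis by (simp add: LIM_zero_iff)
qed

section \<open>Resolvent estimates and decay of the powers on coboundaries\<close>

context power_bounded_operator
begin

text \<open>The Neumann series, summed vector by vector, is the inverse; the bound is the sum of the
  dominating geometric series of ratio \<open>1 / cmod z\<close>.\<close>

lemma resolvent_outside_disc:
  assumes z: "1 < cmod z"
  shows "z \<notin> spectrum T" "norm (resolvent T z x) \<le> M * norm x / (cmod z - 1)"
proof -
  define u where "u = (\<lambda>x n. (1 / z) ^ n *\<^sub>C (T ^^ n) x)"
  define S where "S = (\<lambda>x. (1 / z) *\<^sub>C (\<Sum>n. u x n))"
  define q where "q = 1 / cmod z"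
  have z0: "z \<noteq> 0" using z by auto
  then have q: "0 < q" "q < 1" using z by (simp_all add: q_def)
  have le: "norm (u x n) \<le> M * norm x * q ^ n" for x n
  proof -
    have "norm (u x n) = q ^ n * norm ((T ^^ n) x)"
      by (simp add: u_def q_def norm_scaleC norm_power norm_divide)
    also have "\<dots> \<le> q ^ n * (M * norm x)" using q by (intro mult_left_mono power_le) auto
    finally show ?thesis by (simp add: mult_ac)
  qed
  have geo: "(\<lambda>n. M * norm x * q ^ n) sums (M * norm x * (1 / (1 - q)))" for x
    by (intro sums_mult geometric_sums) (use q in auto)
  have sn: "summable (\<lambda>n. norm (u x n))" for x
    by (rule summable_comparison_test[OF _ sums_summable[OF geo[of x]]]) (use le in auto)
  have sm: "u x sums (\<Sum>n. u x n)" for x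
    by (rule summable_sums[OF summable_norm_cancel[OF sn]])
  have S_le: "norm (S x) \<le> M * norm x / (cmod z - 1)" for x
  proof -
    have "norm (\<Sum>n. u x n) \<le> (\<Sum>n. norm (u x n))" by (rule summable_norm[OF sn])
    also have "\<dots> \<le> M * norm x * (1 / (1 - q))"
      using suminf_le[OF le sn sums_summable[OF geo], of x] geo[of x] by (simp add: sums_iff)
    finally have "q * norm (\<Sum>n. u x n) \<le> q * (M * norm x * (1 / (1 - q)))"
      using q by (intro mult_left_mono) auto
    then have "norm (S x) \<le> q * (M * norm x * (1 / (1 - q)))"
      by (simp add: S_def norm_scaleC norm_divide q_def)
    also have "\<dots> = M * norm x / (cmod z - 1)"
      using z z0 by (simp add: q_def field_simps)
    finally show ?thesis .
  qed
  have S_clinear: "bounded_clinear S"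
  proof (rule bounded_clinearI)
    show "S (x + y) = S x + S y" for x y
    proof -
      have "u (x + y) sums ((\<Sum>n. u x n) + (\<Sum>n. u y n))"
        using sums_add[OF sm[of x] sm[of y]]
        by (simp add: u_def bounded_clinear_add[OF clinear_power] scaleC_add_right)
      then show ?thesis by (simp add: S_def sums_iff scaleC_add_right)
    qed
    show "S (c *\<^sub>C x) = c *\<^sub>C S x" for c x
    proof -
      have "(\<lambda>n. c *\<^sub>C u x n) sums (c *\<^sub>C (\<Sum>n. u x n))"
        by (rule bounded_linear.sums[OF bounded_bilinear.bounded_linear_right[OF bounded_bilinear_scaleC] sm])
      then have "u (c *\<^sub>C x) sums (c *\<^sub>C (\<Sum>n. u x n))"
        by (simp add: u_def bounded_clinear_scaleC[OF clinear_power] scaleC_scaleC mult.commute)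
      then show ?thesis by (simp add: S_def sums_iff scaleC_scaleC mult.commute)
    qed
    show "norm (S x) \<le> M / (cmod z - 1) * norm x" for x using S_le[of x] by simp
  qed
  have bl: "bounded_linear T" using clinear by (simp add: bounded_clinear_def)
  have right: "z *\<^sub>C S x - T (S x) = x" for x
  proof -
    have "(\<lambda>n. (1 / z) *\<^sub>C T (u x n)) sums ((1 / z) *\<^sub>C T (\<Sum>n. u x n))"
      by (rule bounded_linear.sums[OF bounded_bilinear.bounded_linear_right[OF bounded_bilinear_scaleC]
            bounded_linear.sums[OF bl sm]])
    moreover have "(1 / z) *\<^sub>C T (u x n) = u x (Suc n)" for n
      by (simp add: u_def bounded_clinear_scaleC[OF clinear] scaleC_scaleC)
    ultimately have "(\<lambda>n. u x (Suc n)) sums T (S x)"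
      by (simp add: S_def bounded_clinear_scaleC[OF clinear])
    moreover have "(\<lambda>n. u x (Suc n)) sums ((\<Sum>n. u x n) - u x 0)"
      by (subst sums_Suc_iff) (simp add: sm)
    ultimately have "T (S x) = (\<Sum>n. u x n) - u x 0"
      by (rule sums_unique2)
    then have "T (S x) = (\<Sum>n. u x n) - x" by (simp add: u_def)
    then show ?thesis using z0 by (simp add: S_def scaleC_scaleC)
  qed
  have left: "S (z *\<^sub>C x - T x) = x" for x
  proof -
    have "(\<lambda>n. T (u x n)) sums T (\<Sum>n. u x n)" by (rule bounded_linear.sums[OF bl sm])
    moreover have "T (u x n) = u (T x) n" for n
      by (simp add: u_def bounded_clinear_scaleC[OF clinear] power_commute)
    ultimately have "S (T x) = T (S x)"
      by (simp add: S_def sums_iff bounded_clinear_scaleC[OF clinear])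
    then show ?thesis
      using right[of x] by (simp add: bounded_clinear_diff[OF S_clinear] bounded_clinear_scaleC[OF S_clinear])
  qed
  show z_res: "z \<notin> spectrum T"
    unfolding spectrum_def using S_clinear left right by (auto simp: fun_eq_iff)
  have "resolvent T z x = S x"
    using left[of "resolvent T z x"] resolvent_right[OF z_res, of x] by simp
  with S_le show "norm (resolvent T z x) \<le> M * norm x / (cmod z - 1)" by simp
qed

text \<open>At \<open>1 + t\<close> with \<open>t > 0\<close> the resolvent of \<open>x\<close> has
  norm at most \<open>M * norm x / t\<close>. If the order \<open>m\<close> were at least
  \<open>2\<close>, multiplying by \<open>t ^ m\<close> would give the limit \<open>0\<close>, so
  the leading coefficient \<open>U 0\<close> would vanish.\<close>

lemma resolvent_pole_simple:
  assumes "resolvent_pole T 1"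
  shows "\<exists>U. \<forall>x. ((\<lambda>z. (z - 1) *\<^sub>C resolvent T z x) \<longlongrightarrow> U x) (at 1)"
proof -
  obtain m r U where m: "0 < (m::nat)" and r: "0 < (r::real)"
    and U: "\<forall>n::nat. bounded_clinear (U n)" "U 0 \<noteq> (\<lambda>x. 0)"
    and pole: "\<forall>z. 0 < dist z 1 \<and> dist z 1 < r \<longrightarrow> z \<notin> spectrum T \<and>
      (\<lambda>N. onorm (\<lambda>x. (z - 1) ^ m *\<^sub>C resolvent T z x - (\<Sum>n<N. (z - 1) ^ n *\<^sub>C U n x)))
        \<longlonglongrightarrow> 0"
    using assms unfolding resolvent_pole_def by (elim exE conjE) (rule that)
  have scale: "bounded_linear (\<lambda>x. c *\<^sub>C f x)" if "bounded_clinear f" for c and f :: "'a \<Rightarrow> 'a"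
    using that bounded_linear_compose[OF
        bounded_bilinear.bounded_linear_right[OF bounded_bilinear_scaleC], of f c]
    by (simp add: bounded_clinear_def)
  \<comment> \<open>Multiplication by \<open>(z - 1) ^ m\<close> turns the Laurent expansion into a
    power series, and convergence in operator norm gives convergence at each
    \<open>x\<close>.\<close>
  have lim: "((\<lambda>z. (z - 1) ^ m *\<^sub>C resolvent T z x) \<longlongrightarrow> U 0 x) (at 1)" for x
  proof (rule power_series_tendsto_at_centre[OF r])
    fix z :: complex assume z: "0 < dist z 1" "dist z 1 < r"
    define D where
      "D = (\<lambda>N x. (z - 1) ^ m *\<^sub>C resolvent T z x - (\<Sum>n<N. (z - 1) ^ n *\<^sub>C U n x))"
    have D: "bounded_linear (D N)" for N
      unfolding D_def
      by (intro bounded_linear_sub bounded_linear_sum scale resolvent_clinear U[rule_format])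
         (use pole z in auto)
    have "(\<lambda>N. D N x) \<longlonglongrightarrow> 0"
    proof (rule Lim_null_comparison)
      show "\<forall>\<^sub>F N in sequentially. norm (D N x) \<le> onorm (D N) * norm x"
        using onorm[OF D] by (auto intro: always_eventually)
      have "(\<lambda>N. onorm (D N)) \<longlonglongrightarrow> 0" using pole z by (simp add: D_def)
      from tendsto_mult[OF this tendsto_const[of "norm x"]]
      show "(\<lambda>N. onorm (D N) * norm x) \<longlonglongrightarrow> 0" by simp
    qed
    from tendsto_diff[OF tendsto_const[of "(z - 1) ^ m *\<^sub>C resolvent T z x"] this]
    show "(\<lambda>n. (z - 1) ^ n *\<^sub>C U n x) sums ((z - 1) ^ m *\<^sub>C resolvent T z x)"
      by (simp add: D_def sums_def)
  qed
  have "m = 1"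
  proof (rule ccontr)
    assume "m \<noteq> 1"
    \<comment> \<open>Here \<open>k = m - 2\<close>, so \<open>t ^ m / t = t ^ Suc k\<close> still
      has a positive exponent.\<close>
    with m obtain k where k: "m = Suc (Suc k)"
      by (metis One_nat_def gr0_implies_Suc neq0_conv)
    have "U 0 x = 0" for x
    proof -
      have fl: "filterlim (\<lambda>t::real. 1 + complex_of_real t) (at 1) (at_right 0)"
        unfolding filterlim_at
      proof
        have "((\<lambda>t::real. 1 + complex_of_real t) \<longlongrightarrow> 1 + complex_of_real 0) (at_right 0)"
          by (intro tendsto_intros)
        then show "((\<lambda>t::real. 1 + complex_of_real t) \<longlongrightarrow> 1) (at_right 0)" by simp
        show "\<forall>\<^sub>F t::real in at_right 0. 1 + complex_of_real t \<in> UNIV \<and> 1 + complex_of_real t \<noteq> 1"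
          using eventually_at_right_less[of "0::real"] by eventually_elim simp
      qed
      have "((\<lambda>t::real. complex_of_real t ^ m *\<^sub>C resolvent T (1 + complex_of_real t) x)
          \<longlongrightarrow> U 0 x) (at_right 0)"
        using filterlim_compose[OF lim fl, of x] by simp
      moreover have "((\<lambda>t::real. complex_of_real t ^ m *\<^sub>C resolvent T (1 + complex_of_real t) x)
          \<longlongrightarrow> 0) (at_right 0)"
      proof (rule Lim_null_comparison)
        show "\<forall>\<^sub>F t::real in at_right 0. norm (complex_of_real t ^ m *\<^sub>C
            resolvent T (1 + complex_of_real t) x) \<le> t ^ Suc k * (M * norm x)"
          using eventually_at_right_less[of "0::real"]
        proof eventually_elim
          case (elim t)
          have n: "cmod (1 + complex_of_real t) = 1 + t"
            using elim by (metis abs_of_nonneg add_nonneg_nonneg less_imp_le norm_of_real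
                of_real_1 of_real_add zero_le_one)
          have "norm (resolvent T (1 + complex_of_real t) x) \<le> M * norm x / t"
            using resolvent_outside_disc(2)[of "1 + complex_of_real t" x] elim by (simp add: n)
          then have "t ^ m * norm (resolvent T (1 + complex_of_real t) x) \<le> t ^ m * (M * norm x / t)"
            using elim by (intro mult_left_mono) auto
          also have "t ^ m * (M * norm x / t) = t ^ Suc k * (M * norm x)"
            using elim by (simp add: k)
          finally show ?case using elim by (simp add: norm_scaleC norm_power)
        qed
        have "((\<lambda>t::real. t ^ Suc k * (M * norm x)) \<longlongrightarrow> 0 ^ Suc k * (M * norm x)) (at_right 0)"
          by (intro tendsto_intros)
        then show "((\<lambda>t::real. t ^ Suc k * (M * norm x)) \<longlongrightarrow> 0) (at_right 0)" by simp
      qed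
      ultimately show ?thesis by (rule tendsto_unique[OF trivial_limit_at_right_real])
    qed
    with U(2) show False by auto
  qed
  then have "((\<lambda>z. (z - 1) *\<^sub>C resolvent T z x) \<longlongrightarrow> U 0 x) (at 1)" for x
    using lim[of x] by simp
  then show ?thesis by (intro exI[of _ "U 0"] allI)
qed

text \<open>Averaging \<open>h\<close> over the \<open>N\<close>-th roots of unity turns \<open>(z - T) h(z) = z y\<close> into
  \<open>(r\<^sup>N - T\<^sup>N) S\<^sub>N(r) = r\<^sup>N y\<close>. For fixed \<open>r > 1\<close> this forces \<open>S\<^sub>N(r) \<rightarrow> y\<close>, uniform continuity
  of \<open>h\<close> carries the limit over to \<open>r = 1\<close>, and there the identity reads
  \<open>T\<^sup>N S\<^sub>N(1) = S\<^sub>N(1) - y\<close>.\<close>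

lemma powers_tendsto_zero_annulus:
  defines "R \<equiv> {z::complex. 1 \<le> cmod z \<and> cmod z \<le> 2}"
  assumes cont: "continuous_on R h"
    and eq: "\<And>z. z \<in> R \<Longrightarrow> z *\<^sub>C h z - T (h z) = z *\<^sub>C y"
  shows "(\<lambda>n. (T ^^ n) y) \<longlonglongrightarrow> 0"
proof -
  define W where "W = (\<lambda>N::nat. {w::complex. w ^ N = 1})"
  define S where "S = (\<lambda>N r. (1 / real N) *\<^sub>R (\<Sum>w\<in>W N. h (complex_of_real r * w)))"
  have W: "finite (W N)" "card (W N) = N" if "0 < N" for N
    using that by (auto simp: W_def finite_roots_unity card_roots_unity_eq)
  have W1: "cmod w = 1" if "w \<in> W N" "0 < N" for w N
  proof -
    have "cmod w ^ N = 1" using that by (simp add: W_def flip: norm_power)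
    with that(2) show ?thesis using power_eq_imp_eq_base[of "cmod w" N 1] by simp
  qed
  have inR: "complex_of_real r * w \<in> R" if "w \<in> W N" "0 < N" "1 \<le> r" "r \<le> 2" for w N r
    using W1[OF that(1,2)] that by (simp add: R_def norm_mult)
  \<comment> \<open>The factorisation of \<open>z ^ N - T ^^ N\<close> by \<open>z - T\<close>. The
    factor \<open>z\<close> in \<open>eq\<close> raises each exponent by one, to
    \<open>N - j\<close>.\<close>
  have poly: "z ^ N *\<^sub>C h z - (T ^^ N) (h z) = (\<Sum>j<N. z ^ (N - j) *\<^sub>C (T ^^ j) y)"
    if z: "z \<in> R" for z N
  proof (induction N)
    case (Suc N)
    have "z ^ Suc N *\<^sub>C h z - (T ^^ Suc N) (h z) =
        z *\<^sub>C (z ^ N *\<^sub>C h z - (T ^^ N) (h z)) + (T ^^ N) (z *\<^sub>C h z - T (h z))"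
      by (simp add: scaleC_diff_right scaleC_scaleC power_diff power_commute
          bounded_clinear_scaleC[OF clinear_power])
    also have "\<dots> = z *\<^sub>C (\<Sum>j<N. z ^ (N - j) *\<^sub>C (T ^^ j) y) + z *\<^sub>C (T ^^ N) y"
      by (simp add: Suc eq[OF z] bounded_clinear_scaleC[OF clinear_power])
    also have "\<dots> = (\<Sum>j<Suc N. z ^ (Suc N - j) *\<^sub>C (T ^^ j) y)"
      by (simp add: bounded_bilinear.sum_right[OF bounded_bilinear_scaleC] scaleC_scaleC Suc_diff_le)
    finally show ?case .
  qed simp
  have key: "r ^ N *\<^sub>R S N r - (T ^^ N) (S N r) = r ^ N *\<^sub>R y"
    if N: "0 < N" and r: "1 \<le> r" "r \<le> 2" for N r
  proof -
    \<comment> \<open>The exponents \<open>N - j\<close> run from \<open>1\<close> to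
      \<open>N\<close>. Only \<open>j = 0\<close> contributes, where \<open>w ^ N = 1\<close>; all
      smaller exponents sum to \<open>0\<close>.\<close>
    have "(\<Sum>w\<in>W N. (complex_of_real r * w) ^ (N - j)) = (if j = 0 then of_nat N * of_real (r ^ N) else 0)"
      if "j < N" for j
    proof (cases "j = 0")
      case True
      have "(complex_of_real r * w) ^ N = of_real (r ^ N)" if "w \<in> W N" for w
        using that by (simp add: W_def power_mult_distrib)
      with True show ?thesis by (simp add: W[OF N])
    next
      case False
      have "(\<Sum>w\<in>W N. (complex_of_real r * w) ^ (N - j)) = of_real r ^ (N - j) * (\<Sum>w\<in>W N. w ^ (N - j))"
        by (simp add: power_mult_distrib sum_distrib_left)
      with False that show ?thesis by (simp add: W_def sum_powers_roots_unity)
    qed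
    note roots = this
    have h_eq: "r ^ N *\<^sub>R h (complex_of_real r * w) - (T ^^ N) (h (complex_of_real r * w)) =
        (\<Sum>j<N. (complex_of_real r * w) ^ (N - j) *\<^sub>C (T ^^ j) y)" if "w \<in> W N" for w
      using poly[OF inR[OF that N r], of N] that
      by (simp add: power_mult_distrib W_def scaleC_of_real flip: of_real_power)
    have "(\<Sum>w\<in>W N. r ^ N *\<^sub>R h (complex_of_real r * w) - (T ^^ N) (h (complex_of_real r * w))) =
        (\<Sum>w\<in>W N. \<Sum>j<N. (complex_of_real r * w) ^ (N - j) *\<^sub>C (T ^^ j) y)"
      by (intro sum.cong refl h_eq)
    also have "\<dots> = (\<Sum>j<N. (\<Sum>w\<in>W N. (complex_of_real r * w) ^ (N - j)) *\<^sub>C (T ^^ j) y)"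
      by (subst sum.swap) (simp add: bounded_bilinear.sum_left[OF bounded_bilinear_scaleC])
    also have "\<dots> = (\<Sum>j<N. if j = 0 then (of_nat N * of_real (r ^ N)) *\<^sub>C y else 0)"
      by (intro sum.cong refl) (simp add: roots)
    also have "\<dots> = complex_of_real (real N * r ^ N) *\<^sub>C y" using N by simp
    also have "\<dots> = (real N * r ^ N) *\<^sub>R y" by (rule scaleC_of_real)
    finally have "(1 / real N) *\<^sub>R (\<Sum>w\<in>W N. r ^ N *\<^sub>R h (complex_of_real r * w) -
        (T ^^ N) (h (complex_of_real r * w))) = r ^ N *\<^sub>R y"
      using N by simp
    then show ?thesis
      by (simp add: S_def bounded_clinear_scaleR[OF clinear_power] bounded_clinear_sum[OF clinear_power]
          sum_subtractf scaleR_diff_right scaleR_sum_right mult.commute)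
  qed
  have "compact R"
  proof -
    have "R = cball 0 2 - ball 0 1" by (auto simp: R_def)
    then show ?thesis by (simp add: compact_diff)
  qed
  then have unif: "uniformly_continuous_on R h" using cont compact_uniformly_continuous by blast
  have "bounded (h ` R)" using cont \<open>compact R\<close> compact_continuous_image compact_imp_bounded by blast
  then obtain B where B: "0 < B" "\<And>z. z \<in> R \<Longrightarrow> norm (h z) \<le> B"
    by (auto simp: bounded_pos)
  have mean_le: "norm ((1 / real N) *\<^sub>R (\<Sum>w\<in>W N. g w)) \<le> b"
    if "0 < N" "\<And>w. w \<in> W N \<Longrightarrow> norm (g w) \<le> b" for N b and g :: "complex \<Rightarrow> 'a"
    using sum_norm_bound[of "W N" g b] that W(2)[OF that(1)] by (simp add: field_simps)
  have lim: "(\<lambda>N. S N 1) \<longlonglongrightarrow> y"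
  proof (rule LIMSEQ_I)
    fix e :: real assume e: "0 < e"
    then obtain d where d: "0 < d" "\<And>z w. z \<in> R \<Longrightarrow> w \<in> R \<Longrightarrow> dist w z < d \<Longrightarrow> dist (h w) (h z) < e / 2"
      using unif[unfolded uniformly_continuous_on_def, rule_format, of "e / 2"] by auto
    \<comment> \<open>A radius beyond \<open>1\<close> but within the modulus of continuity
      \<open>d\<close>; the minimum with \<open>1\<close> keeps it in the annulus.\<close>
    define r where "r = 1 + min 1 (d / 2)"
    have r: "1 < r" "r \<le> 2" "r - 1 < d" using d(1) by (auto simp: r_def min_def)
    \<comment> \<open>This bound is uniform in \<open>N\<close>, so \<open>r\<close> stays fixed
      while \<open>N\<close> grows in the next estimate.\<close>
    have close: "norm (S N 1 - S N r) \<le> e / 2" if N: "0 < N" for N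
    proof -
      have "norm (h (complex_of_real 1 * w) - h (complex_of_real r * w)) \<le> e / 2" if w: "w \<in> W N" for w
      proof -
        have "complex_of_real 1 * w - complex_of_real r * w = complex_of_real (1 - r) * w"
          by (simp add: algebra_simps)
        then have "dist (complex_of_real 1 * w) (complex_of_real r * w) = r - 1"
          using W1[OF w N] r(1) by (simp only: dist_norm norm_mult norm_of_real) simp
        then show ?thesis
          using d(2)[OF inR[OF w N, of r] inR[OF w N, of 1]] r by (simp add: dist_norm)
      qed
      from mean_le[OF N this] show ?thesis
        by (simp add: S_def sum_subtractf scaleR_diff_right)
    qed
    have far: "norm (S N r - y) \<le> M * B * (1 / r) ^ N" if N: "0 < N" for N
    proof -
      have "norm (S N r) \<le> B"
        unfolding S_def by (rule mean_le[OF N]) (use B inR[OF _ N] r in auto)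
      then have "M * norm (S N r) \<le> M * B" using M_nonneg by (intro mult_left_mono)
      then have TB: "norm ((T ^^ N) (S N r)) \<le> M * B" using power_le[of N "S N r"] by linarith
      have "r ^ N *\<^sub>R (S N r - y) = (T ^^ N) (S N r)"
        using key[OF N, of r] r by (simp add: scaleR_diff_right diff_eq_eq eq_diff_eq add.commute)
      from arg_cong[OF this, of norm] have "r ^ N * norm (S N r - y) \<le> M * B"
        using TB r by simp
      then show ?thesis using r by (simp add: pos_le_divide_eq power_divide mult.commute)
    qed
    have "(\<lambda>N. M * B * (1 / r) ^ N) \<longlonglongrightarrow> M * B * 0"
      by (intro tendsto_mult tendsto_const LIMSEQ_power_zero) (use r in auto)
    then obtain N0 where N0: "\<And>N. N \<ge> N0 \<Longrightarrow> norm (M * B * (1 / r) ^ N) < e / 2"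
      using LIMSEQ_D[of "\<lambda>N. M * B * (1 / r) ^ N" 0 "e / 2"] e by auto
    have "norm (S N 1 - y) < e" if "N \<ge> Suc N0" for N
    proof -
      have "M * B * (1 / r) ^ N < e / 2" using N0[of N] that by simp
      then show ?thesis
        using close[of N] far[of N] that norm_triangle_ineq[of "S N 1 - S N r" "S N r - y"] by simp
    qed
    then show "\<exists>N0. \<forall>N\<ge>N0. norm (S N 1 - y) < e" by blast
  qed
  then have null: "(\<lambda>N. S N 1 - y) \<longlonglongrightarrow> 0" by (simp add: LIM_zero)
  show ?thesis
  proof (rule Lim_null_comparison)
    show "\<forall>\<^sub>F N in sequentially. norm ((T ^^ N) y) \<le> (1 + M) * norm (S N 1 - y)"
      using eventually_gt_at_top[of 0]
    proof eventually_elim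
      case (elim N)
      have "(T ^^ N) (S N 1) = S N 1 - y" using key[OF elim, of 1] by (simp add: diff_eq_eq eq_diff_eq add.commute)
      then have "(T ^^ N) y = (S N 1 - y) - (T ^^ N) (S N 1 - y)" by (simp add: power_diff)
      then have "norm ((T ^^ N) y) \<le> norm (S N 1 - y) + norm ((T ^^ N) (S N 1 - y))"
        by (simp only: norm_triangle_ineq4)
      with power_le[of N "S N 1 - y"] show ?case by (simp add: algebra_simps)
    qed
    show "(\<lambda>N. (1 + M) * norm (S N 1 - y)) \<longlonglongrightarrow> 0"
      using tendsto_mult[OF tendsto_const[of "1 + M"] tendsto_norm[OF null]] by simp
  qed
qed

text \<open>The function fed into the annulus lemma is \<open>z *\<^sub>C (x - k z)\<close>, where
  \<open>k\<close> extends \<open>(z - 1) *\<^sub>C resolvent T z x\<close> to \<open>1\<close>.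
  Away from \<open>1\<close>, \<open>x - k z\<close> equals \<open>(I - T)\<close> applied to
  \<open>resolvent T z x\<close>, so this is the function announced above in a form continuous at
  \<open>1\<close>.\<close>

lemma powers_coboundary_tendsto_zero:
  assumes circle: "spectrum T \<inter> sphere 0 1 \<subseteq> {1}" and pole: "resolvent_pole T 1"
  shows "(\<lambda>n. (T ^^ n) (x - T x)) \<longlonglongrightarrow> 0"
proof -
  obtain U where "\<forall>x. ((\<lambda>z. (z - 1) *\<^sub>C resolvent T z x) \<longlongrightarrow> U x) (at 1)"
    using resolvent_pole_simple[OF pole] ..
  then have U: "((\<lambda>z. (z - 1) *\<^sub>C resolvent T z x) \<longlongrightarrow> U x) (at 1)" for x ..
  define R where "R = {z::complex. 1 \<le> cmod z \<and> cmod z \<le> 2}"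
  have res: "z \<notin> spectrum T" if "z \<in> R" "z \<noteq> 1" for z
  proof (cases "cmod z = 1")
    case True
    with that circle show ?thesis by auto
  next
    case False
    with that show ?thesis by (intro resolvent_outside_disc) (auto simp: R_def)
  qed
  \<comment> \<open>The value at \<open>1\<close> is the limit provided by the simple pole.\<close>
  define k where "k = (\<lambda>z. if z = 1 then U x else (z - 1) *\<^sub>C resolvent T z x)"
  have k_lim: "(k \<longlongrightarrow> U x) (at 1)"
    by (rule Lim_transform_eventually[OF U]) (auto simp: k_def eventually_at_filter)
  have "continuous_on R k"
    unfolding continuous_on_def
  proof
    fix z assume z: "z \<in> R"
    show "(k \<longlongrightarrow> k z) (at z within R)"
    proof (cases "z = 1")
      case True
      then show ?thesis using tendsto_within_subset[OF k_lim] by (simp add: k_def)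
    next
      case False
      have "continuous_on (R - {1}) (\<lambda>z. (z - 1) *\<^sub>C resolvent T z x)"
        by (intro bounded_bilinear.continuous_on[OF bounded_bilinear_scaleC] continuous_intros
            continuous_on_subset[OF continuous_on_resolvent]) (use res in auto)
      then have "continuous_on (R - {1}) k"
        by (rule continuous_on_eq) (auto simp: k_def)
      then have "(k \<longlongrightarrow> k z) (at z within R - {1})"
        using z False by (simp add: continuous_on_def)
      moreover have "at z within R - {1} = at z within R"
        by (rule at_within_nhd[of _ "- {1}"]) (use False in auto)
      ultimately show ?thesis by simp
    qed
  qed
  have T_lim: "((\<lambda>z. z *\<^sub>C k z - T (k z)) \<longlongrightarrow> 1 *\<^sub>C U x - T (U x)) (at 1 within R)"
    by (intro tendsto_diff bounded_bilinear.tendsto[OF bounded_bilinear_scaleC]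
        bounded_clinear_tendsto[OF clinear] tendsto_within_subset[OF k_lim] tendsto_ident_at) auto
  have k_eq: "z *\<^sub>C k z - T (k z) = (z - 1) *\<^sub>C x" if "z \<in> R" "z \<noteq> 1" for z
  proof -
    have "z *\<^sub>C k z - T (k z) = (z - 1) *\<^sub>C (z *\<^sub>C resolvent T z x - T (resolvent T z x))"
      using that by (simp add: k_def bounded_clinear_scaleC[OF clinear] scaleC_diff_right
          scaleC_scaleC mult.commute)
    then show ?thesis using resolvent_right[OF res[OF that], of x] by simp
  qed
  \<comment> \<open>Let \<open>z\<close> tend to \<open>1\<close> inside \<open>R\<close> in
    \<open>k_eq\<close>. The points \<open>1 + t\<close> with small \<open>t > 0\<close> show that
    \<open>1\<close> is a limit point of \<open>R\<close>.\<close>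
  have U_fixed: "T (U x) = U x"
  proof -
    have "((\<lambda>z. (z - 1) *\<^sub>C x) \<longlongrightarrow> (1 - 1) *\<^sub>C x) (at 1 within R)"
      by (intro bounded_bilinear.tendsto[OF bounded_bilinear_scaleC] tendsto_intros)
    moreover have "((\<lambda>z. (z - 1) *\<^sub>C x) \<longlongrightarrow> 1 *\<^sub>C U x - T (U x)) (at 1 within R)"
      by (rule Lim_transform_eventually[OF T_lim]) (auto simp: eventually_at_filter k_eq)
    moreover have "at 1 within R \<noteq> bot"
      unfolding trivial_limit_within islimpt_approachable
    proof clarsimp
      fix e :: real assume e: "0 < e"
      define t where "t = min 1 (e / 2)"
      have t: "0 < t" "t \<le> 1" "t < e" using e by (auto simp: t_def min_def)
      have "cmod (1 + complex_of_real t) = 1 + t"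
        using t by (metis abs_of_nonneg add_nonneg_nonneg less_imp_le norm_of_real
            of_real_1 of_real_add zero_le_one)
      with t show "\<exists>z\<in>R. z \<noteq> 1 \<and> dist z 1 < e"
        by (intro bexI[of _ "1 + complex_of_real t"]) (auto simp: R_def dist_norm)
    qed
    ultimately have "(1 - 1) *\<^sub>C x = 1 *\<^sub>C U x - T (U x)"
      using tendsto_unique by metis
    then show ?thesis by simp
  qed
  show ?thesis
  proof (rule powers_tendsto_zero_annulus[folded R_def])
    show "continuous_on R (\<lambda>z. z *\<^sub>C (x - k z))"
      by (intro bounded_bilinear.continuous_on[OF bounded_bilinear_scaleC] continuous_intros
          \<open>continuous_on R k\<close>)
    fix z assume z: "z \<in> R"
    have kz: "z *\<^sub>C k z - T (k z) = (z - 1) *\<^sub>C x"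
      using k_eq[OF z] U_fixed by (cases "z = 1") (auto simp: k_def)
    have "z *\<^sub>C (z *\<^sub>C (x - k z)) - T (z *\<^sub>C (x - k z)) =
        z *\<^sub>C (z *\<^sub>C x - T x - (z *\<^sub>C k z - T (k z)))"
      by (simp add: scaleC_diff_right bounded_clinear_scaleC[OF clinear] bounded_clinear_diff[OF clinear])
    also have "\<dots> = z *\<^sub>C (x - T x)" by (simp add: kz scaleC_diff_left)
    finally show "z *\<^sub>C (z *\<^sub>C (x - k z)) - T (z *\<^sub>C (x - k z)) = z *\<^sub>C (x - T x)" .
  qed
qed

lemma powers_closure_coboundaries:
  assumes "spectrum T \<inter> sphere 0 1 \<subseteq> {1}" "resolvent_pole T 1" "x \<in> closure coboundaries"
  shows "(\<lambda>n. (T ^^ n) x) \<longlonglongrightarrow> 0"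
proof (rule tendsto_zero_on_closure[OF power_diff power_le _ assms(3)])
  fix y assume "y \<in> coboundaries"
  then obtain v where "y = v - T v" by blast
  then show "(\<lambda>n. (T ^^ n) y) \<longlonglongrightarrow> 0"
    using powers_coboundary_tendsto_zero[OF assms(1,2)] by simp
qed

end

section \<open>The spectral domains and the composed function\<close>

text \<open>In Cartesian form openness and convexity are read off from inequalities between real and
  imaginary parts.\<close>

lemma sector_eq:
  assumes \<Theta>: "0 < \<Theta>" "\<Theta> < pi / 2"
  shows "sector \<Theta> = {z. 0 < Re z \<and> \<bar>Im z\<bar> < tan \<Theta> * Re z}"
proof (intro set_eqI iffI)
  fix z assume "z \<in> sector \<Theta>"
  then obtain r \<theta> where z: "z = complex_of_real r * cis \<theta>" "0 < r" "\<bar>\<theta>\<bar> < \<Theta>"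
    by (auto simp: sector_def)
  have c: "0 < cos \<theta>" using z(3) \<Theta> by (intro cos_gt_zero_pi) auto
  have "tan \<theta> < tan \<Theta>" by (rule tan_monotone) (use z(3) \<Theta> in auto)
  moreover have "tan (- \<theta>) < tan \<Theta>" by (rule tan_monotone) (use z(3) \<Theta> in auto)
  ultimately have "\<bar>tan \<theta>\<bar> < tan \<Theta>" by simp
  moreover have "sin \<theta> = tan \<theta> * cos \<theta>" using c by (simp add: tan_def)
  ultimately have "\<bar>sin \<theta>\<bar> < tan \<Theta> * cos \<theta>" using c by (simp add: abs_mult)
  then have "r * \<bar>sin \<theta>\<bar> < r * (tan \<Theta> * cos \<theta>)" using z(2) by simp
  then show "z \<in> {z. 0 < Re z \<and> \<bar>Im z\<bar> < tan \<Theta> * Re z}"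
    using z c by (simp add: abs_mult mult_ac)
next
  fix z assume "z \<in> {z. 0 < Re z \<and> \<bar>Im z\<bar> < tan \<Theta> * Re z}"
  then have z: "0 < Re z" "\<bar>Im z\<bar> < tan \<Theta> * Re z" by auto
  define t where "t = Im z / Re z"
  have "\<bar>t\<bar> < tan \<Theta>" using z by (simp add: t_def field_simps)
  then have "arctan t < arctan (tan \<Theta>)" "arctan (- t) < arctan (tan \<Theta>)"
    unfolding arctan_less_iff by auto
  moreover have "arctan (tan \<Theta>) = \<Theta>" by (rule arctan_tan) (use \<Theta> in auto)
  ultimately have "\<bar>arctan t\<bar> < \<Theta>" by (simp add: arctan_minus)
  moreover have pos: "0 < sqrt (1 + t\<^sup>2)" by (simp add: add_pos_nonneg)
  \<comment> \<open>Modulus and argument expressed through the slope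
    \<open>t = Im z / Re z\<close>.\<close>
  then have "z = complex_of_real (Re z * sqrt (1 + t\<^sup>2)) * cis (arctan t)"
    using z(1) by (simp add: complex_eq_iff cos_arctan sin_arctan t_def)
  moreover have "0 < Re z * sqrt (1 + t\<^sup>2)" using z(1) pos by simp
  ultimately show "z \<in> sector \<Theta>" unfolding sector_def by blast
qed

lemma open_sector: "0 < \<Theta> \<Longrightarrow> \<Theta> < pi / 2 \<Longrightarrow> open (sector \<Theta>)"
  unfolding sector_eq
  by (intro open_Collect_conj open_Collect_less continuous_intros)

lemma convex_sector:
  assumes \<Theta>: "0 < \<Theta>" "\<Theta> < pi / 2"
  shows "convex (sector \<Theta>)"
  unfolding sector_eq[OF \<Theta>]
proof (rule convexI, clarsimp)
  fix x y :: complex and u v :: real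
  assume x: "0 < Re x" "\<bar>Im x\<bar> < tan \<Theta> * Re x" and y: "0 < Re y" "\<bar>Im y\<bar> < tan \<Theta> * Re y"
    and uv: "0 \<le> u" "0 \<le> v" "u + v = 1"
  show "0 < u * Re x + v * Re y \<and> \<bar>u * Im x + v * Im y\<bar> < tan \<Theta> * (u * Re x + v * Re y)"
  proof (cases "u = 0")
    case True
    with uv y show ?thesis by simp
  next
    case False
    with uv have u: "0 < u" by simp
    have "\<bar>u * Im x + v * Im y\<bar> \<le> u * \<bar>Im x\<bar> + v * \<bar>Im y\<bar>"
      using uv abs_triangle_ineq[of "u * Im x" "v * Im y"] by (simp add: abs_mult)
    also have "\<dots> < u * (tan \<Theta> * Re x) + v * (tan \<Theta> * Re y)"
      using u uv x y by (intro add_less_le_mono mult_strict_left_mono mult_left_mono) auto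
    finally show ?thesis
      using u uv x y by (auto simp: algebra_simps intro!: add_pos_nonneg)
  qed
qed

text \<open>A neighbourhood of the vertex contains negative reals, which the sector does
  not.\<close>

lemma sector_thin_vertex:
  assumes \<Theta>: "0 < \<Theta>" "\<Theta> < pi / 2" and U: "open U" "U \<subseteq> insert 0 (sector \<Theta>)"
  shows "U \<subseteq> sector \<Theta>"
proof -
  have "0 \<notin> U"
  proof
    assume "0 \<in> U"
    with U(1) obtain e where e: "0 < e" "ball 0 e \<subseteq> U" by (auto simp: open_contains_ball)
    then have "complex_of_real (- e / 2) \<in> U" by (intro subsetD[OF e(2)]) simp
    with U(2) e(1) show False by (auto simp: sector_eq[OF \<Theta>])
  qed
  with U(2) show ?thesis by auto
qed

lemma closure_sector_subset:
  assumes "0 < \<Theta>" "\<Theta> < pi / 2"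
  shows "closure (sector \<Theta>) \<subseteq> {z. 0 \<le> Re z}"
  by (rule closure_minimal)
     (auto simp: sector_eq[OF assms] closed_halfspace_Re_ge)

lemma stolz_hull_subset: "convex hull (insert 1 (cball 0 (sin \<gamma>))) \<subseteq> cball (0::complex) 1"
  by (rule hull_minimal) (auto intro: order_trans[OF _ sin_le_one])

text \<open>The vertex \<open>1\<close> belongs to the convex hull, so \<open>U\<close> is an open
  subset of the hull and lies in its interior.\<close>

lemma stolz_thin_vertex:
  assumes "open U" "U \<subseteq> insert 1 (stolz \<gamma>)"
  shows "U \<subseteq> stolz \<gamma>"
proof -
  let ?H = "convex hull (insert (1::complex) (cball 0 (sin \<gamma>)))"
  have "1 \<in> ?H" by (simp add: hull_inc)
  then have "U \<subseteq> ?H" using assms(2) interior_subset[of ?H] by (auto simp: stolz_def)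
  with assms(1) show ?thesis by (simp add: stolz_def interior_maximal)
qed

lemma closure_stolz_subset: "closure (stolz \<gamma>) \<subseteq> cball 0 1"
  unfolding stolz_def
  by (rule closure_minimal) (use interior_subset stolz_hull_subset in blast)+

text \<open>\<open>E\<close> collects the values allowed outside the domain, and \<open>thin\<close>
  says that no open set can make use of them. A nonconstant composition has an open image, which
  therefore lies in \<open>\<Omega>\<close>. After a constant one the next composition is constant
  too, whatever value \<open>\<phi> (Suc k)\<close> takes there.\<close>

lemma compose_upto_Hinf:
  assumes \<Omega>: "open \<Omega>" "connected \<Omega>"
    and thin: "\<And>U. open U \<Longrightarrow> U \<subseteq> \<Omega> \<union> E \<Longrightarrow> U \<subseteq> \<Omega>"
    and \<phi>: "\<And>k. k \<in> {1..K} \<Longrightarrow> \<phi> k \<in> Hinf \<Omega>"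
    and comp: "\<And>k. k \<in> {1..<K} \<Longrightarrow> compose_upto \<phi> k ` \<Omega> \<subseteq> \<Omega> \<union> E"
    and k: "1 \<le> k" "k \<le> K"
  shows "compose_upto \<phi> k \<in> Hinf \<Omega>"
  using k
\<comment> \<open>The induction starts at \<open>1\<close>, because the identity is unbounded on a
  sector.\<close>
proof (induction k rule: dec_induct)
  case base
  then show ?case using \<phi>[of 1] by simp
next
  case (step k)
  let ?g = "compose_upto \<phi> k"
  have g: "?g holomorphic_on \<Omega>" using step by (simp add: Hinf_def)
  have \<phi>k: "\<phi> (Suc k) \<in> Hinf \<Omega>" using \<phi> step by simp
  show ?case
  proof (cases "?g constant_on \<Omega>")
    case True
    then obtain c where c: "\<And>z. z \<in> \<Omega> \<Longrightarrow> ?g z = c" by (auto simp: constant_on_def)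
    have "compose_upto \<phi> (Suc k) holomorphic_on \<Omega>"
      by (rule holomorphic_transform[of "\<lambda>_. \<phi> (Suc k) c"]) (auto simp: c)
    moreover have "compose_upto \<phi> (Suc k) ` \<Omega> \<subseteq> {\<phi> (Suc k) c}" using c by auto
    then have "bounded (compose_upto \<phi> (Suc k) ` \<Omega>)" by (rule bounded_subset[rotated]) simp
    ultimately show ?thesis unfolding Hinf_def by blast
  next
    case False
    have "open (?g ` \<Omega>)" by (rule open_mapping_thm[OF g \<Omega> \<Omega>(1) subset_refl False])
    then have sub: "?g ` \<Omega> \<subseteq> \<Omega>" by (rule thin) (use comp step in auto)
    have "compose_upto \<phi> (Suc k) holomorphic_on \<Omega>"
      using holomorphic_on_compose_gen[OF g _ sub] \<phi>k by (simp add: Hinf_def)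
    moreover have "bounded (compose_upto \<phi> (Suc k) ` \<Omega>)"
      using \<phi>k sub by (auto simp: Hinf_def image_comp[symmetric] intro: bounded_subset image_mono)
    ultimately show ?thesis unfolding Hinf_def by blast
  qed
qed

section \<open>Powers in the functional calculus and comparison of limits\<close>

lemma Hinf_power: "g \<in> Hinf \<Omega> \<Longrightarrow> (\<lambda>z. g z ^ n) \<in> Hinf \<Omega>"
proof -
  assume g: "g \<in> Hinf \<Omega>"
  then obtain B where "\<And>z. z \<in> \<Omega> \<Longrightarrow> cmod (g z) \<le> B" by (auto simp: Hinf_def bounded_iff)
  then have "\<And>z. z \<in> \<Omega> \<Longrightarrow> cmod (g z ^ n) \<le> B ^ n" by (simp add: norm_power power_mono)
  then have "bounded ((\<lambda>z. g z ^ n) ` \<Omega>)" by (auto simp: bounded_iff)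
  moreover have "(\<lambda>z. g z ^ n) holomorphic_on \<Omega>"
    using g by (intro holomorphic_intros) (simp add: Hinf_def)
  ultimately show ?thesis by (simp add: Hinf_def)
qed

lemma bounded_Hinf_calculus_power:
  assumes \<Phi>: "bounded_Hinf_calculus \<Omega> A \<Phi>" and g: "g \<in> Hinf \<Omega>"
  shows "\<Phi> (\<lambda>z. g z ^ n) = \<Phi> g ^^ n"
proof (induction n)
  case 0
  have "\<Phi> (\<lambda>z. 1) = id" using \<Phi> unfolding bounded_Hinf_calculus_def by blast
  then show ?case by simp
next
  case (Suc n)
  have "\<forall>g\<in>Hinf \<Omega>. \<forall>h\<in>Hinf \<Omega>. \<Phi> (\<lambda>z. g z * h z) = \<Phi> g \<circ> \<Phi> h"
    using \<Phi> unfolding bounded_Hinf_calculus_def by (elim conjE) assumption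
  from bspec[OF bspec[OF this g] Hinf_power[OF g, of n]] show ?case
    by (simp add: Suc)
qed

text \<open>Once a strong limit \<open>P\<close> exists it is also a weak limit, and weak limits are
  unique because functionals separate points.\<close>

lemma weak_limit_iff_strong_limit:
  fixes S :: "nat \<Rightarrow> 'a::complex_banach \<Rightarrow> 'a"
  assumes P: "strong_limit S P"
  shows "weak_limit S Q \<longleftrightarrow> strong_limit S Q"
proof
  assume "strong_limit S Q"
  then show "weak_limit S Q"
    unfolding strong_limit_def weak_limit_def
    by (intro allI impI) (erule bounded_clinear_tendsto, erule spec)
next
  assume Q: "weak_limit S Q"
  have "Q x = P x" for x
  proof (rule clinear_functionals_separate)
    fix f :: "'a \<Rightarrow> complex" assume f: "bounded_clinear f"
    have "(\<lambda>N. f (S N x)) \<longlonglongrightarrow> f (P x)"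
      using P by (intro bounded_clinear_tendsto[OF f]) (simp add: strong_limit_def)
    moreover have "(\<lambda>N. f (S N x)) \<longlonglongrightarrow> f (Q x)"
      using Q f by (simp add: weak_limit_def)
    ultimately show "f (Q x) = f (P x)" by (rule LIMSEQ_unique[rotated])
  qed
  then have "Q = P" by (rule ext)
  with P show "strong_limit S Q" by simp
qed

lemma ergodic_mean_commute:
  assumes A: "bounded_clinear A" and comm: "\<And>x. T (A x) = A (T x)"
  shows "ergodic_mean T N (A x) = A (ergodic_mean T N x)"
proof -
  have "(T ^^ n) (A x) = A ((T ^^ n) x)" for n
    by (induction n) (simp_all add: comm)
  then show ?thesis
    by (simp add: ergodic_mean_def bounded_clinear_scaleR[OF A] bounded_clinear_sum[OF A])
qed

lemma power_bounded_imp_operator: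
  assumes "power_bounded T"
  shows "\<exists>M. power_bounded_operator T M"
proof -
  obtain M where T: "bounded_clinear T" and M: "\<And>n. onorm (T ^^ n) \<le> M"
    using assms by (auto simp: power_bounded_def)
  have bl: "bounded_linear (T ^^ n)" for n
    using bounded_clinear_funpow[OF T] by (simp add: bounded_clinear_def)
  have "norm ((T ^^ n) x) \<le> M * norm x" for n x
    using onorm[OF bl, of n x] mult_right_mono[OF M norm_ge_zero, of n x] by linarith
  moreover have "0 \<le> M" using onorm_pos_le[OF bl, of 0] M[of 0] by linarith
  ultimately show ?thesis using T by (auto simp: power_bounded_operator_def)
qed

section \<open>The ergodic projection and the powers of \<open>\<Phi> \<Psi>\<close>\<close>

theorem theorem3p1:
  fixes A :: "'a::complex_banach \<Rightarrow> 'a"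
    and \<Omega> :: "complex set"
    and \<Phi> :: "(complex \<Rightarrow> complex) \<Rightarrow> 'a \<Rightarrow> 'a"
    and \<phi> :: "nat \<Rightarrow> complex \<Rightarrow> complex"
    and \<Psi> :: "complex \<Rightarrow> complex"
    and K :: nat
  assumes reflexive: "reflexive_space TYPE('a)"
    and power_bounded: "power_bounded A"
    and discrete_or_continuous:
      "(\<exists>\<gamma>. 0 < \<gamma> \<and> \<gamma> < pi / 2 \<and> ritt_operator_of_angle A \<gamma> \<and> \<Omega> = stolz \<gamma>) \<or>
       (\<exists>\<Theta> S. 0 < \<Theta> \<and> \<Theta> < pi / 2 \<and> spectrum A \<subseteq> insert 0 (sector \<Theta>) \<and>
          bounded_holomorphic_semigroup S \<and> generates (\<lambda>x. - A x) S \<and> \<Omega> = sector \<Theta>)"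
    and calculus: "bounded_Hinf_calculus \<Omega> A \<Phi>"
    and K: "1 \<le> K"
    and \<phi>_Hinf: "\<And>k. k \<in> {1..K} \<Longrightarrow> \<phi> k \<in> Hinf \<Omega>"
    and \<phi>_vertex: "\<And>k. k \<in> {1..K} \<Longrightarrow> continuous_on (\<Omega> \<union> spectrum A \<union> {1}) (\<phi> k)"
    and \<phi>_le_1: "\<And>k z. k \<in> {1..K} \<Longrightarrow> z \<in> spectrum A \<Longrightarrow> cmod (\<phi> k z) \<le> 1"
    and \<phi>_1: "\<And>k. k \<in> {1..K} \<Longrightarrow> \<phi> k 1 = 1"
    and composable: "\<And>k. k \<in> {1..<K} \<Longrightarrow> compose_upto \<phi> k ` \<Omega> \<subseteq> \<Omega> \<union> spectrum A \<union> {1}"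
    and \<Psi>: "\<Psi> = compose_upto \<phi> K"
    and \<Psi>_power_bounded: "power_bounded (\<Phi> \<Psi>)"
  shows "\<exists>P. bounded_clinear P \<and>
    strong_limit (ergodic_mean (\<Phi> \<Psi>)) P \<and>
    (\<forall>Q. bounded_clinear Q \<longrightarrow>
       (weak_limit (ergodic_mean (\<Phi> \<Psi>)) Q \<longleftrightarrow> strong_limit (ergodic_mean (\<Phi> \<Psi>)) Q)) \<and>
    P \<circ> P = P \<and> P \<circ> \<Phi> \<Psi> = P \<and> \<Phi> \<Psi> \<circ> P = P \<and>
    range P = {x. x - \<Phi> \<Psi> x = 0} \<and> range P = {x. \<Phi> \<Psi> x = x} \<and>
    P \<circ> A = A \<circ> P \<and>
    (spectrum (\<Phi> \<Psi>) \<inter> sphere 0 1 \<subseteq> {1} \<and> 1 isolated_in spectrum (\<Phi> \<Psi>) \<and>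
       resolvent_pole (\<Phi> \<Psi>) 1 \<longrightarrow>
       strong_limit (\<lambda>n. \<Phi> \<Psi> ^^ n) P \<and>
       (\<forall>n\<ge>1. iterative_sequence A (\<Phi> \<Psi>) n = \<Phi> (\<lambda>z. \<Psi> z ^ n) \<and>
               iterative_sequence A (\<Phi> \<Psi>) n = \<Phi> \<Psi> ^^ n) \<and>
       strong_limit (iterative_sequence A (\<Phi> \<Psi>)) P)"
proof -
  let ?T = "\<Phi> \<Psi>"
  have \<Psi>_Hinf: "\<Psi> \<in> Hinf \<Omega>" and \<mu>: "\<exists>\<mu>. \<mu> \<notin> closure \<Omega> \<and> \<mu> \<notin> spectrum A"
  proof -
    \<comment> \<open>What the two cases share. The point \<open>\<mu>\<close> serves the
      commutation of \<open>\<Phi> \<Psi>\<close> with \<open>A\<close>: the calculus knows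
      \<open>A\<close> through \<open>resolvent A \<mu>\<close>.\<close>
    have "open \<Omega> \<and> connected \<Omega> \<and> (\<forall>U. open U \<longrightarrow> U \<subseteq> \<Omega> \<union> (spectrum A \<union> {1}) \<longrightarrow> U \<subseteq> \<Omega>) \<and>
        (\<exists>\<mu>. \<mu> \<notin> closure \<Omega> \<and> \<mu> \<notin> spectrum A)"
      using discrete_or_continuous
    proof (elim disjE exE conjE)
      fix \<gamma> assume \<gamma>: "ritt_operator_of_angle A \<gamma>" "\<Omega> = stolz \<gamma>"
      have "spectrum A \<subseteq> cball 0 1" "\<Omega> \<union> (spectrum A \<union> {1}) \<subseteq> insert 1 (stolz \<gamma>)"
        using \<gamma> by (auto simp: ritt_operator_of_angle_def ritt_operator_def)
      moreover from this have "2 \<notin> closure \<Omega> \<and> 2 \<notin> spectrum A"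
        using closure_stolz_subset[of \<gamma>] \<gamma>(2) by (auto dest!: subsetD)
      moreover have "open \<Omega>" "convex \<Omega>" by (auto simp: \<gamma>(2) stolz_def convex_interior)
      ultimately show ?thesis
        using stolz_thin_vertex[of _ \<gamma>] \<gamma>(2) convex_connected by (metis subset_trans)
    next
      fix \<Theta> assume \<Theta>: "0 < \<Theta>" "\<Theta> < pi / 2" "spectrum A \<subseteq> insert 0 (sector \<Theta>)" "\<Omega> = sector \<Theta>"
      \<comment> \<open>In the sector case \<open>1\<close> is an interior point and the only extra
        value is the vertex \<open>0\<close>; in the Stolz case \<open>1\<close> is itself the
        vertex.\<close>
      have "1 \<in> sector \<Theta>" using \<Theta>(1,2) by (simp add: sector_eq tan_gt_zero)
      then have "\<Omega> \<union> (spectrum A \<union> {1}) \<subseteq> insert 0 (sector \<Theta>)" using \<Theta>(3,4) by auto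
      moreover have "- 1 \<notin> closure \<Omega> \<and> - 1 \<notin> spectrum A"
        using closure_sector_subset[OF \<Theta>(1,2)] \<Theta>(3,4) by (auto simp: sector_eq[OF \<Theta>(1,2)])
      moreover have "open \<Omega>" "connected \<Omega>"
        using \<Theta> open_sector convex_sector convex_connected by auto
      ultimately show ?thesis
        using sector_thin_vertex[OF \<Theta>(1,2)] \<Theta>(4) by (metis subset_trans)
    qed
    then show "\<exists>\<mu>. \<mu> \<notin> closure \<Omega> \<and> \<mu> \<notin> spectrum A"
      and "\<Psi> \<in> Hinf \<Omega>"
      using compose_upto_Hinf[of \<Omega> "spectrum A \<union> {1}" K \<phi> K] \<phi>_Hinf composable K
      by (auto simp: \<Psi> Un_assoc)
  qed
  then obtain \<mu> where "\<mu> \<notin> closure \<Omega>" "\<mu> \<notin> spectrum A" by blast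
  from bounded_Hinf_calculus_commute[OF calculus \<Psi>_Hinf this]
  have comm: "?T (A x) = A (?T x)" for x by (simp add: fun_eq_iff)
  have A: "bounded_clinear A" using power_bounded by (simp add: power_bounded_def)
  obtain M where "power_bounded_operator ?T M"
    using power_bounded_imp_operator[OF \<Psi>_power_bounded] by blast
  then interpret T: power_bounded_operator ?T M .
  obtain P where P: "bounded_clinear P" "strong_limit (ergodic_mean ?T) P"
    "\<And>x. ?T (P x) = P x" "\<And>x. P (?T x) = P x" "\<And>x. P x = x \<longleftrightarrow> ?T x = x"
    "\<And>x. x - P x \<in> closure (range (\<lambda>x. x - ?T x))"
    by (rule T.mean_ergodic[OF reflexive]) (rule that)
  have lim: "(\<lambda>N. ergodic_mean ?T N x) \<longlonglongrightarrow> P x" for x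
    using P(2) by (simp add: strong_limit_def)
  have PP: "P (P x) = P x" for x using P(3,5) by simp
  have range: "range P = {x. ?T x = x}"
  proof (intro set_eqI iffI)
    fix x assume "x \<in> {x. ?T x = x}"
    then have "P x = x" using P(5) by simp
    then show "x \<in> range P" by (rule range_eqI[OF sym])
  qed (use P(3) in auto)
  \<comment> \<open>The means commute with \<open>A\<close>; continuity of \<open>A\<close> carries
    this to the limit.\<close>
  have PA: "P (A x) = A (P x)" for x
    using bounded_clinear_tendsto[OF A lim[of x]] lim[of "A x"]
    by (intro LIMSEQ_unique[of "\<lambda>N. ergodic_mean ?T N (A x)"])
       (simp_all add: ergodic_mean_commute[where T = ?T, OF A comm])
  have calc: "iterative_sequence A ?T n = \<Phi> (\<lambda>z. \<Psi> z ^ n) \<and> iterative_sequence A ?T n = ?T ^^ n"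
    if "1 \<le> n" for n
    using that by (simp add: iterative_sequence_def bounded_Hinf_calculus_power[OF calculus \<Psi>_Hinf])
  have powers: "strong_limit (\<lambda>n. ?T ^^ n) P" "strong_limit (iterative_sequence A ?T) P"
    if "spectrum ?T \<inter> sphere 0 1 \<subseteq> {1}" "resolvent_pole ?T 1"
  proof -
    \<comment> \<open>The powers tend to \<open>0\<close> on \<open>x - P x\<close> and leave
      \<open>P x\<close> fixed.\<close>
    have conv: "(\<lambda>n. (?T ^^ n) x) \<longlonglongrightarrow> P x" for x
      using tendsto_add[OF T.powers_closure_coboundaries[OF that P(6), of x] tendsto_const[of "P x"]]
      by (simp add: T.power_diff T.power_fixed[OF P(3)])
    then show "strong_limit (\<lambda>n. ?T ^^ n) P" by (simp add: strong_limit_def)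
    \<comment> \<open>The sequence starts with \<open>A\<close> at index \<open>0\<close>, so it
      agrees with the powers only from \<open>n = 1\<close> on.\<close>
    have "(\<lambda>n. iterative_sequence A ?T n x) \<longlonglongrightarrow> P x" for x
      by (rule Lim_transform_eventually[OF conv], rule eventually_mono[OF eventually_ge_at_top[of 1]])
         (simp add: iterative_sequence_def)
    then show "strong_limit (iterative_sequence A ?T) P" by (simp add: strong_limit_def)
  qed
  show ?thesis
  proof (intro exI[of _ P] conjI allI impI)
    show "range P = {x. x - ?T x = 0}" unfolding range by auto
    show "iterative_sequence A ?T n = \<Phi> (\<lambda>z. \<Psi> z ^ n)" "iterative_sequence A ?T n = ?T ^^ n"
      if "1 \<le> n" for n
      using calc[OF that] by auto
  qed (use P range PP PA powers weak_limit_iff_strong_limit[OF P(2)] in \<open>auto simp: fun_eq_iff\<close>)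
qed

end
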